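(* Let $k\ge0$, let $\sigma\in\mathbb R$ be a constant and let $p\in\{1,2,3\}$. Let $v$ be the exact solution of $v_t-\frac{\sigma^2}{2}v_{xx}=0$ on $(0,1)\times(0,T)$ with periodic boundary conditions and $v(0,\cdot)=v_0$, and assume that $v$ has a bounded derivative $\frac{\partial^q v}{\partial x^q}$ for $q=\max(k+2,2p+2)$. Let $v^n=v(t_n,\cdot)$ and let $(u^n)$ be given by the SLDG-$p$ scheme with $u^0=\Pi v_0$. Then there is a constant $C\ge 0$, independent of $\Delta t,\Delta x,n$, such that $$\|v^n-u^n\|_{L^2}\le\|v^0-u^0\|_{L^2}+C\,T\Big(\frac{\Delta x^{k+1}}{\Delta t}+\Delta t^p\Big),\qquad\forall\,0\le n\le N.$$ Furthermore, the same result holds for $p=2$ when the SLDG-2 scheme is replaced by its variant, and for $p=3$ when the SLDG-3 scheme is replaced by its variant.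
   Context: Setting. $\Omega=(0,1)$; functions on $\Omega$ are identified with their $1$-periodic extensions to $\mathbb R$. $L^2=L^2(\Omega)$. $T>0$, $N\ge1$ integer, $\Delta t=T/N$, $t_n=n\Delta t$. $M\ge1$ integer, $\Delta x=1/M$, cells $I_i=(i\Delta x,(i+1)\Delta x)$, $i=0,\dots,M-1$. $V_k=\{v\in L^2(\Omega):v|_{I_i}\text{ is a polynomial of degree}\le k,\ \forall i\}$. $\Pi$ is the $L^2$-orthogonal projection onto $V_k$. Operators. $(S^0_{\Delta t}u)(x)=\frac12\big(u(x-\sigma\sqrt{\Delta t})+u(x+\sigma\sqrt{\Delta t})\big)$ and $S_{\Delta t}:=\Pi S^0_{\Delta t}$. Schemes: - SLDG-1: $u^{n+1}=S_{\Delta t}u^n$. - SLDG-2: $u^{n+1}=\frac13\big(u^n+S_{\Delta t}u^n+S_{\Delta t}S_{\Delta t}u^n\big)$; variant: $u^{n+1}=\Pi\,\frac13\big(u^n+S^0_{\Delta t}u^n+S^0_{\Delta t}S^0_{\Delta t}u^n\big)$. - SLDG-3: $u^{n+1}=\frac{13}{45}u^n+\frac{7}{15}S_{\Delta t}u^n+\frac15S_{\Delta t}S_{\Delta t}u^n+\frac{2}{45}S_{\Delta t}S_{\Delta t}S_{\Delta t}u^n$; variant: $u^{n+1}=\Pi\big(\frac{13}{45}u^n+\frac{7}{15}S^0_{\Delta t}u^n+\frac15S^0_{\Delta t}S^0_{\Delta t}u^n+\frac{2}{45}S^0_{\Delta t}S^0_{\Delta t}S^0_{\Delta t}u^n\big)$.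 *)

theory Defs
  imports "HOL-Analysis.Analysis" "HOL-Computational_Algebra.Polynomial"
begin

text \<open>
  Elements of \<open>L\<^sup>2(0,1)\<close> are represented by their 1-periodic extensions, as functions on the whole
  real line.  The number of cells is \<open>M\<close>, so that \<open>\<Delta>x = 1 / M\<close>, and \<open>\<tau>\<close> is the time step \<open>\<Delta>t\<close>.
\<close>

definition L2_inner :: "(real \<Rightarrow> real) \<Rightarrow> (real \<Rightarrow> real) \<Rightarrow> real" where
  "L2_inner f g = (LINT x:{0<..<1}|lebesgue. f x * g x)"

definition L2_norm01 :: "(real \<Rightarrow> real) \<Rightarrow> real" where
  "L2_norm01 f = sqrt (L2_inner f f)"

text \<open>
  The values at the cell interfaces, a null set, are left unconstrained.
\<close>

definition DG_space :: "nat \<Rightarrow> nat \<Rightarrow> (real \<Rightarrow> real) set" where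
  "DG_space k M = {f. (\<forall>x. f (x + 1) = f x) \<and>
     (\<forall>i<M. \<exists>P :: real poly. degree P \<le> k \<and>
        (\<forall>x\<in>{real i / real M <..< real (i + 1) / real M}. f x = poly P x))}"

text \<open>
  The \<open>L\<^sup>2\<close>-orthogonal projection onto the finite-dimensional space \<open>DG_space k M\<close>.  It is unique up
  to the values at the cell interfaces; the choice operator picks one representative.
\<close>

definition DG_proj :: "nat \<Rightarrow> nat \<Rightarrow> (real \<Rightarrow> real) \<Rightarrow> (real \<Rightarrow> real)" where
  "DG_proj k M f = (SOME g. g \<in> DG_space k M \<and>
     (\<forall>w\<in>DG_space k M. L2_inner (\<lambda>x. f x - g x) w = 0))"

definition S0_op :: "real \<Rightarrow> real \<Rightarrow> (real \<Rightarrow> real) \<Rightarrow> (real \<Rightarrow> real)" where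
  "S0_op \<sigma> \<tau> u = (\<lambda>x. (u (x - \<sigma> * sqrt \<tau>) + u (x + \<sigma> * sqrt \<tau>)) / 2)"

definition S_op :: "nat \<Rightarrow> nat \<Rightarrow> real \<Rightarrow> real \<Rightarrow> (real \<Rightarrow> real) \<Rightarrow> (real \<Rightarrow> real)" where
  "S_op k M \<sigma> \<tau> u = DG_proj k M (S0_op \<sigma> \<tau> u)"

definition SLDG1 :: "nat \<Rightarrow> nat \<Rightarrow> real \<Rightarrow> real \<Rightarrow> (real \<Rightarrow> real) \<Rightarrow> (real \<Rightarrow> real)" where
  "SLDG1 k M \<sigma> \<tau> u = S_op k M \<sigma> \<tau> u"

definition SLDG2 :: "nat \<Rightarrow> nat \<Rightarrow> real \<Rightarrow> real \<Rightarrow> (real \<Rightarrow> real) \<Rightarrow> (real \<Rightarrow> real)" where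
  "SLDG2 k M \<sigma> \<tau> u =
     (\<lambda>x. (u x + S_op k M \<sigma> \<tau> u x + S_op k M \<sigma> \<tau> (S_op k M \<sigma> \<tau> u) x) / 3)"

definition SLDG2_variant :: "nat \<Rightarrow> nat \<Rightarrow> real \<Rightarrow> real \<Rightarrow> (real \<Rightarrow> real) \<Rightarrow> (real \<Rightarrow> real)" where
  "SLDG2_variant k M \<sigma> \<tau> u =
     DG_proj k M (\<lambda>x. (u x + S0_op \<sigma> \<tau> u x + S0_op \<sigma> \<tau> (S0_op \<sigma> \<tau> u) x) / 3)"

definition SLDG3 :: "nat \<Rightarrow> nat \<Rightarrow> real \<Rightarrow> real \<Rightarrow> (real \<Rightarrow> real) \<Rightarrow> (real \<Rightarrow> real)" where
  "SLDG3 k M \<sigma> \<tau> u =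
     (\<lambda>x. 13/45 * u x + 7/15 * S_op k M \<sigma> \<tau> u x
          + 1/5 * S_op k M \<sigma> \<tau> (S_op k M \<sigma> \<tau> u) x
          + 2/45 * S_op k M \<sigma> \<tau> (S_op k M \<sigma> \<tau> (S_op k M \<sigma> \<tau> u)) x)"

definition SLDG3_variant :: "nat \<Rightarrow> nat \<Rightarrow> real \<Rightarrow> real \<Rightarrow> (real \<Rightarrow> real) \<Rightarrow> (real \<Rightarrow> real)" where
  "SLDG3_variant k M \<sigma> \<tau> u =
     DG_proj k M (\<lambda>x. 13/45 * u x + 7/15 * S0_op \<sigma> \<tau> u x
          + 1/5 * S0_op \<sigma> \<tau> (S0_op \<sigma> \<tau> u) x
          + 2/45 * S0_op \<sigma> \<tau> (S0_op \<sigma> \<tau> (S0_op \<sigma> \<tau> u)) x)"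

text \<open>Only the values \<open>p = 1, 2, 3\<close> are meaningful.\<close>

definition SLDG :: "nat \<Rightarrow> nat \<Rightarrow> nat \<Rightarrow> real \<Rightarrow> real \<Rightarrow> (real \<Rightarrow> real) \<Rightarrow> (real \<Rightarrow> real)" where
  "SLDG p = (if p = 1 then SLDG1 else if p = 2 then SLDG2 else SLDG3)"

text \<open>
  Classical solutions \<open>v t x\<close> of \<open>v\<^sub>t - \<sigma>\<^sup>2/2 v\<^sub>x\<^sub>x = 0\<close>, periodic in \<open>x\<close>.  The equation is posed for
  \<open>0 < t < T\<close>; continuity on the closed time interval is what ties \<open>v\<close> to its initial value and
  to the value at the final time.
\<close>

definition periodic_heat_solution ::
    "real \<Rightarrow> real \<Rightarrow> (real \<Rightarrow> real) \<Rightarrow> (real \<Rightarrow> real \<Rightarrow> real) \<Rightarrow> bool" where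
  "periodic_heat_solution \<sigma> T v0 v \<longleftrightarrow>
     continuous_on ({0..T} \<times> UNIV) (\<lambda>(t, x). v t x) \<and>
     (\<forall>t\<in>{0..T}. \<forall>x. v t (x + 1) = v t x) \<and>
     (\<forall>x. v 0 x = v0 x) \<and>
     (\<forall>t\<in>{0<..<T}. \<forall>x.
        v t differentiable (at x) \<and> deriv (v t) differentiable (at x) \<and>
        ((\<lambda>s. v s x) has_real_derivative \<sigma>\<^sup>2 / 2 * deriv (deriv (v t)) x) (at t))"

text \<open>
  The \<open>q\<close>-th derivative in \<open>x\<close> exists for all \<open>0 < t < T\<close> and is bounded uniformly in \<open>(t, x)\<close>.
\<close>

definition bounded_x_derivative :: "nat \<Rightarrow> real \<Rightarrow> (real \<Rightarrow> real \<Rightarrow> real) \<Rightarrow> bool" where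
  "bounded_x_derivative q T v \<longleftrightarrow>
     (\<forall>t\<in>{0<..<T}. \<forall>j<q. \<forall>x. (deriv ^^ j) (v t) differentiable (at x)) \<and>
     (\<exists>B. \<forall>t\<in>{0<..<T}. \<forall>x. \<bar>(deriv ^^ q) (v t) x\<bar> \<le> B)"

end

theory Submission
  imports Defs
begin

text \<open>
  With \<open>S\<^sup>0\<close> in place of \<open>S\<close>, one step of each scheme averages \<open>u\<close> over the positions of a random walk
  whose moments agree with those of the heat kernel, so on the exact solution it has a local error
  of order \<open>\<tau>\<^bsup>p+1\<^esup>\<close>.  Translations and the projection do not increase the \<open>L\<^sup>2\<close> norm and the weights
  are convex, so the actual scheme does not amplify errors; each of its at most three projections
  adds \<open>O(h\<^bsup>k+1\<^esup>)\<close>, since it acts on averages of translates of the smooth function \<open>v t\<close>.  Summing the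
  local errors over at most \<open>T / \<tau>\<close> steps gives the claim.  Bounds on the lower order derivatives come
  from periodicity, and the end points \<open>t = 0\<close> and \<open>t = T\<close> are reached by continuity.
\<close>

section \<open>Periodic functions and the \<open>L\<^sup>2\<close> inner product\<close>

text \<open>Formally \<open>S0_op\<close> is cosh y with y = \<sigma> \<surd>\<tau> d/dx, and the
  heat semigroup over one time step is exp(y^2 / 2). The weights c_l of the schemes are chosen so
  that the sum of c_l cosh(y)^l equals exp(y^2 / 2) + O(y^(2 p + 2)); this is the origin of 1/3,
  13/45 and the other fractions.

  The numerical solution is only piecewise polynomial, and translation moves its jumps into the
  interior of cells, so projection errors cannot be measured on it. Every comparison therefore
  passes through the projection-free scheme applied to the exact solution.

  Functions are used instead of classes modulo null sets, and the projection is a choice that is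
  fixed only up to interface values. Hence the arguments go through norms of differences and not
  through pointwise identities such as linearity. Bounded Borel functions make all products
  integrable, contain both the continuous solution and all of \<open>DG_space\<close> for
  \<open>M \<ge> 1\<close>, and are closed under translation and projection.\<close>

definition periodic_bdd :: "(real \<Rightarrow> real) set" where
  "periodic_bdd = {f. f \<in> borel_measurable borel \<and> (\<exists>B. \<forall>x. \<bar>f x\<bar> \<le> B) \<and> (\<forall>x. f (x + 1) = f x)}"

lemma periodic_bddI:
  assumes "f \<in> borel_measurable borel" "\<And>x. \<bar>f x\<bar> \<le> B" "\<And>x. f (x + 1) = f x"
  shows "f \<in> periodic_bdd"
  using assms by (auto simp: periodic_bdd_def)

lemma periodic_bdd_measurable: "f \<in> periodic_bdd \<Longrightarrow> f \<in> borel_measurable borel"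
  by (simp add: periodic_bdd_def)

lemma periodic_bdd_add:
  assumes "f \<in> periodic_bdd" "g \<in> periodic_bdd"
  shows "(\<lambda>x. f x + g x) \<in> periodic_bdd"
proof -
  obtain A B where "\<forall>x. \<bar>f x\<bar> \<le> A" "\<forall>x. \<bar>g x\<bar> \<le> B"
    using assms unfolding periodic_bdd_def by blast
  then have "\<bar>f x + g x\<bar> \<le> A + B" for x
    by (meson abs_triangle_ineq add_mono order_trans)
  with assms show ?thesis
    by (intro periodic_bddI[where B = "A + B"]) (auto simp: periodic_bdd_def)
qed

lemma periodic_bdd_mult:
  assumes "f \<in> periodic_bdd" "g \<in> periodic_bdd"
  shows "(\<lambda>x. f x * g x) \<in> periodic_bdd"
proof -
  obtain A B where "\<forall>x. \<bar>f x\<bar> \<le> A" "\<forall>x. \<bar>g x\<bar> \<le> B"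
    using assms unfolding periodic_bdd_def by blast
  then have "\<bar>f x * g x\<bar> \<le> A * B" for x
    unfolding abs_mult by (intro mult_mono) (auto intro: order_trans[OF abs_ge_zero])
  with assms show ?thesis
    by (intro periodic_bddI[where B = "A * B"]) (auto simp: periodic_bdd_def)
qed

lemma periodic_bdd_const: "(\<lambda>x. c) \<in> periodic_bdd"
  by (intro periodic_bddI[where B = "\<bar>c\<bar>"]) auto

lemma periodic_bdd_cmult: "f \<in> periodic_bdd \<Longrightarrow> (\<lambda>x. c * f x) \<in> periodic_bdd"
  by (rule periodic_bdd_mult[OF periodic_bdd_const])

lemma periodic_bdd_diff:
  assumes "f \<in> periodic_bdd" "g \<in> periodic_bdd"
  shows "(\<lambda>x. f x - g x) \<in> periodic_bdd"
  using periodic_bdd_add[OF assms(1) periodic_bdd_cmult[OF assms(2), of "-1"]] by simp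

lemma periodic_bdd_shift:
  assumes "f \<in> periodic_bdd"
  shows "(\<lambda>x. f (x + a)) \<in> periodic_bdd"
proof -
  have [measurable]: "f \<in> borel_measurable borel"
    using assms by (rule periodic_bdd_measurable)
  have "f (x + 1 + a) = f (x + a)" for x
    using assms by (simp add: periodic_bdd_def add.assoc add.commute[of 1 a]) (simp add: add.assoc[symmetric])
  with assms show ?thesis
    by (auto simp: periodic_bdd_def)
qed

lemma periodic_add_int:
  assumes "\<And>x::real. f (x + 1) = f x"
  shows "f (x + of_int n) = f x"
proof (induction n arbitrary: x rule: int_induct[where k = 0])
  case (step1 i)
  then show ?case
    using assms[of "x + of_int i"] by (simp add: add.assoc)
next
  case (step2 i)
  then show ?case
    using assms[of "x + of_int i - 1"] by (simp add: algebra_simps)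
qed simp

lemma periodic_frac:
  assumes "\<And>x::real. f (x + 1) = f x"
  shows "f (frac x) = f x"
  using periodic_add_int[of f "frac x" "\<lfloor>x\<rfloor>", OF assms] by (simp add: frac_def)

lemma periodic_bdd_integrable_on:
  assumes "f \<in> periodic_bdd"
  shows "set_integrable lebesgue {a..b} f" "set_integrable lebesgue {a<..<b} f"
proof -
  obtain B where B: "\<forall>x. \<bar>f x\<bar> \<le> B"
    using assms unfolding periodic_bdd_def by blast
  have [measurable]: "f \<in> borel_measurable borel"
    by (rule periodic_bdd_measurable[OF assms])
  have "set_integrable lebesgue S f" if S: "S \<in> sets borel" "bounded S" for S
  proof -
    have fin: "emeasure lborel S < \<infinity>"
      using S(2) by (rule emeasure_bounded_finite)
    have "integrable lborel (\<lambda>x. indicat_real S x *\<^sub>R f x)"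
    proof (rule Bochner_Integration.integrable_bound)
      show "integrable lborel (\<lambda>x. indicat_real S x * B)"
        using S fin by simp
      show "AE x in lborel. norm (indicat_real S x *\<^sub>R f x) \<le> norm (indicat_real S x * B)"
        using B by (intro AE_I2) (auto simp: indicator_def intro: order_trans[OF _ abs_ge_self])
      show "(\<lambda>x. indicat_real S x *\<^sub>R f x) \<in> borel_measurable lborel"
        using S by measurable
    qed
    then show ?thesis
      unfolding set_integrable_def by (subst integrable_completion) auto
  qed
  then show "set_integrable lebesgue {a..b} f" "set_integrable lebesgue {a<..<b} f"
    using bounded_subset[OF bounded_closed_interval, of "{a<..<b}" a b] by auto
qed

section \<open>Integration over one period\<close>

definition unit_integral :: "(real \<Rightarrow> real) \<Rightarrow> real" where
  "unit_integral f = (LINT x:{0<..<1}|lebesgue. f x)"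

lemma unit_integral_HK:
  assumes "f \<in> periodic_bdd"
  shows "unit_integral f = integral {0..1} f"
  unfolding unit_integral_def
  using periodic_bdd_integrable_on(2)[OF assms, of 0 1]
  by (subst set_lebesgue_integral_eq_integral) (auto simp: integral_open_interval_real)

lemma unit_integral_add:
  assumes "f \<in> periodic_bdd" "g \<in> periodic_bdd"
  shows "unit_integral (\<lambda>x. f x + g x) = unit_integral f + unit_integral g"
  unfolding unit_integral_def
  using assms by (intro set_integral_add periodic_bdd_integrable_on)

lemma unit_integral_cmult: "unit_integral (\<lambda>x. c * f x) = c * unit_integral f"
  unfolding unit_integral_def by simp

text \<open>Only \<open>frac a\<close> matters. The window \<open>{r..1 + r}\<close> is cut at 1,
  and its right-hand piece is moved back by one period to \<open>{0..r}\<close>.\<close>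

lemma unit_integral_shift:
  assumes f: "f \<in> periodic_bdd"
  shows "unit_integral (\<lambda>x. f (x + a)) = unit_integral f"
proof -
  have per: "f (x + 1) = f x" for x
    using f by (simp add: periodic_bdd_def)
  have int: "f integrable_on {c..d}" for c d
    using periodic_bdd_integrable_on(1)[OF f] by (rule set_lebesgue_integral_eq_integral(1))
  define r where "r = frac a"
  have r: "0 \<le> r" "r \<le> 1"
    unfolding r_def using frac_lt_1[of a] by auto
  have "f (x + a) = f (x + r)" for x
    using periodic_add_int[of f "x + r" "\<lfloor>a\<rfloor>", OF per] by (simp add: r_def frac_def)
  then have "unit_integral (\<lambda>x. f (x + a)) = integral {0..1} (\<lambda>x. f (x + r))"
    using unit_integral_HK[OF periodic_bdd_shift[OF f, of r]] by simp
  also have "\<dots> = integral {r..1 + r} f"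
    using integral_shift_Icc_real[of 0 1 f r] by (simp add: o_def add.commute)
  also have "\<dots> = integral {r..1} f + integral {1..1 + r} f"
    using r int by (simp add: Henstock_Kurzweil_Integration.integral_combine)
  also have "integral {1..1 + r} f = integral {0..r} f"
    using integral_shift_Icc_real[of 0 r f 1] per by (simp add: o_def add.commute)
  also have "integral {r..1} f + integral {0..r} f = integral {0..1} f"
    using r int Henstock_Kurzweil_Integration.integral_combine[of 0 r 1 f] by simp
  finally show ?thesis
    using unit_integral_HK[OF f] by simp
qed

section \<open>The inner product, the Cauchy-Schwarz inequality and the norm\<close>

lemma L2_inner_unit_integral: "L2_inner f g = unit_integral (\<lambda>x. f x * g x)"
  by (simp add: L2_inner_def unit_integral_def)

lemma L2_inner_commute: "L2_inner f g = L2_inner g f"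
  by (simp add: L2_inner_def mult.commute)

lemma L2_inner_add_left:
  assumes "f \<in> periodic_bdd" "g \<in> periodic_bdd" "h \<in> periodic_bdd"
  shows "L2_inner (\<lambda>x. f x + g x) h = L2_inner f h + L2_inner g h"
  unfolding L2_inner_unit_integral distrib_right
  using assms by (intro unit_integral_add periodic_bdd_mult)

lemma L2_inner_cmult_left: "L2_inner (\<lambda>x. c * f x) h = c * L2_inner f h"
  using unit_integral_cmult[of c "\<lambda>x. f x * h x"] by (simp add: L2_inner_unit_integral mult.assoc)

lemma L2_inner_diff_left:
  assumes "f \<in> periodic_bdd" "g \<in> periodic_bdd" "h \<in> periodic_bdd"
  shows "L2_inner (\<lambda>x. f x - g x) h = L2_inner f h - L2_inner g h"
  using L2_inner_add_left[OF assms(1) periodic_bdd_cmult[OF assms(2), of "-1"] assms(3)]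
    L2_inner_cmult_left[of "-1" g h] by simp

lemma L2_inner_add_right:
  assumes "f \<in> periodic_bdd" "g \<in> periodic_bdd" "h \<in> periodic_bdd"
  shows "L2_inner h (\<lambda>x. f x + g x) = L2_inner h f + L2_inner h g"
  using L2_inner_add_left[OF assms] by (simp add: L2_inner_commute)

lemma L2_inner_diff_right:
  assumes "f \<in> periodic_bdd" "g \<in> periodic_bdd" "h \<in> periodic_bdd"
  shows "L2_inner h (\<lambda>x. f x - g x) = L2_inner h f - L2_inner h g"
  using L2_inner_diff_left[OF assms] by (simp add: L2_inner_commute)

lemma L2_inner_cmult_right: "L2_inner h (\<lambda>x. c * f x) = c * L2_inner h f"
  using L2_inner_cmult_left[of c f h] by (simp add: L2_inner_commute)

lemma L2_inner_nonneg: "0 \<le> L2_inner f f"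
  unfolding L2_inner_def set_lebesgue_integral_def
  by (intro Bochner_Integration.integral_nonneg) (auto simp: indicator_def)

lemma L2_norm01_nonneg: "0 \<le> L2_norm01 f"
  by (simp add: L2_norm01_def L2_inner_nonneg)

lemma L2_norm01_square: "(L2_norm01 f)\<^sup>2 = L2_inner f f"
  by (simp add: L2_norm01_def L2_inner_nonneg)

lemma L2_inner_add_self:
  assumes "f \<in> periodic_bdd" "g \<in> periodic_bdd"
  shows "L2_inner (\<lambda>x. f x + g x) (\<lambda>x. f x + g x) = L2_inner f f + 2 * L2_inner f g + L2_inner g g"
  using assms
  by (simp add: L2_inner_add_left L2_inner_add_right periodic_bdd_add L2_inner_commute[of g f])

text \<open>Discriminant argument: \<open>quad\<close> is evaluated at its minimiser
  \<open>- c / b\<close>. The form is only semidefinite on functions, so \<open>b = 0\<close> can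
  occur for nonzero \<open>g\<close>; then the expression is affine in \<open>t\<close>, and it is
  bounded below only if \<open>c = 0\<close>.\<close>

lemma L2_inner_square_le:
  assumes f: "f \<in> periodic_bdd" and g: "g \<in> periodic_bdd"
  shows "(L2_inner f g)\<^sup>2 \<le> L2_inner f f * L2_inner g g"
proof -
  define a b c where "a = L2_inner f f" and "b = L2_inner g g" and "c = L2_inner f g"
  have quad: "0 \<le> a + 2 * t * c + t\<^sup>2 * b" for t
    using L2_inner_nonneg[of "\<lambda>x. f x + t * g x"]
      L2_inner_add_self[OF f periodic_bdd_cmult[OF g, of t]]
    by (simp add: a_def b_def c_def L2_inner_cmult_left L2_inner_cmult_right power2_eq_square mult.assoc)
  show ?thesis
  proof (cases "b = 0")
    case True
    have "c = 0"
    proof (rule ccontr)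
      assume "c \<noteq> 0"
      \<comment> \<open>At this \<open>t\<close> the affine expression equals -1.\<close>
      then show False
        using quad[of "- (a + 1) / (2 * c)"] True by (simp add: field_simps)
    qed
    then show ?thesis
      using True by (simp add: a_def b_def c_def)
  next
    case False
    then have "b > 0"
      using L2_inner_nonneg[of g] by (simp add: b_def)
    then have "a + 2 * (- c / b) * c + (- c / b)\<^sup>2 * b = (a * b - c\<^sup>2) / b"
      by (simp add: field_simps power2_eq_square)
    then show ?thesis
      using quad[of "- c / b"] \<open>b > 0\<close> by (simp add: a_def b_def c_def zero_le_divide_iff)
  qed
qed

lemma L2_inner_le_norm:
  assumes "f \<in> periodic_bdd" "g \<in> periodic_bdd"
  shows "L2_inner f g \<le> L2_norm01 f * L2_norm01 g"
  using real_le_rsqrt[OF L2_inner_square_le[OF assms]] by (simp add: L2_norm01_def real_sqrt_mult)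

lemma L2_norm01_triangle:
  assumes "f \<in> periodic_bdd" "g \<in> periodic_bdd"
  shows "L2_norm01 (\<lambda>x. f x + g x) \<le> L2_norm01 f + L2_norm01 g"
proof (rule power2_le_imp_le)
  show "(L2_norm01 (\<lambda>x. f x + g x))\<^sup>2 \<le> (L2_norm01 f + L2_norm01 g)\<^sup>2"
    using L2_inner_le_norm[OF assms]
    by (simp add: L2_norm01_square L2_inner_add_self[OF assms] power2_sum)
qed (simp add: L2_norm01_nonneg)

lemma L2_norm01_cmult: "L2_norm01 (\<lambda>x. c * f x) = \<bar>c\<bar> * L2_norm01 f"
  by (simp add: L2_norm01_def L2_inner_cmult_left L2_inner_cmult_right real_sqrt_mult
      flip: mult.assoc)

lemma L2_norm01_shift:
  assumes "f \<in> periodic_bdd"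
  shows "L2_norm01 (\<lambda>x. f (x + a)) = L2_norm01 f"
  using unit_integral_shift[OF periodic_bdd_mult[OF assms assms], of a]
  by (simp add: L2_norm01_def L2_inner_unit_integral)

text \<open>Elements of \<open>DG_space\<close> may take any value at the cell interfaces; this
  exchanges them for a fixed representative inside an inner product.\<close>

lemma L2_inner_cong_finite:
  assumes "finite S" "\<And>x. x \<in> {0<..<1} - S \<Longrightarrow> g x = g' x"
    and "f \<in> periodic_bdd" "g \<in> periodic_bdd" "g' \<in> periodic_bdd"
  shows "L2_inner f g = L2_inner f g'"
proof -
  have "integral {0..1} (\<lambda>x. f x * g x) = integral {0..1} (\<lambda>x. f x * g' x)"
    using assms(1,2) by (intro integral_spike[where S = "S \<union> {0, 1}"]) (auto intro: negligible_finite)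
  then show ?thesis
    using assms(3-5) by (simp add: L2_inner_unit_integral unit_integral_HK periodic_bdd_mult)
qed

lemma L2_norm01_le_bound:
  assumes "f \<in> periodic_bdd" "\<And>x. x \<in> {0<..<1} \<Longrightarrow> \<bar>f x\<bar> \<le> c" "0 \<le> c"
  shows "L2_norm01 f \<le> c"
proof -
  have "unit_integral (\<lambda>x. f x * f x) \<le> unit_integral (\<lambda>x. c * c)"
    unfolding unit_integral_def
  proof (rule set_integral_mono)
    fix x :: real
    assume "x \<in> {0<..<1}"
    then show "f x * f x \<le> c * c"
      using assms(2,3) by (metis abs_ge_zero abs_mult_self_eq mult_mono)
  qed (intro periodic_bdd_integrable_on periodic_bdd_mult periodic_bdd_const assms(1))+
  also have "\<dots> = c\<^sup>2"
    using unit_integral_HK[OF periodic_bdd_const] by (simp add: power2_eq_square)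
  finally show ?thesis
    using \<open>0 \<le> c\<close> by (simp add: L2_norm01_def L2_inner_unit_integral real_le_lsqrt)
qed

section \<open>The discontinuous Galerkin projection\<close>

lemma DG_space_periodic: "f \<in> DG_space k M \<Longrightarrow> f (x + 1) = f x"
  by (simp add: DG_space_def)

lemma DG_space_zero: "(\<lambda>x. 0) \<in> DG_space k M"
  by (auto simp: DG_space_def intro: exI[of _ 0])

lemma DG_space_add:
  assumes "f \<in> DG_space k M" "g \<in> DG_space k M"
  shows "(\<lambda>x. f x + g x) \<in> DG_space k M"
proof -
  have "\<exists>P :: real poly. degree P \<le> k \<and>
      (\<forall>x\<in>{real i / real M <..< real (i + 1) / real M}. f x + g x = poly P x)" if i: "i < M" for i
  proof -
    obtain P Q :: "real poly" where
      "degree P \<le> k" "\<forall>x\<in>{real i / real M <..< real (i + 1) / real M}. f x = poly P x"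
      "degree Q \<le> k" "\<forall>x\<in>{real i / real M <..< real (i + 1) / real M}. g x = poly Q x"
      using assms i unfolding DG_space_def by blast
    then show ?thesis
      by (intro exI[of _ "P + Q"]) (auto intro: degree_add_le)
  qed
  then show ?thesis
    using assms by (simp add: DG_space_def)
qed

lemma DG_space_cmult:
  assumes "f \<in> DG_space k M"
  shows "(\<lambda>x. c * f x) \<in> DG_space k M"
proof -
  have "\<exists>P :: real poly. degree P \<le> k \<and>
      (\<forall>x\<in>{real i / real M <..< real (i + 1) / real M}. c * f x = poly P x)" if i: "i < M" for i
  proof -
    obtain P :: "real poly" where
      "degree P \<le> k" "\<forall>x\<in>{real i / real M <..< real (i + 1) / real M}. f x = poly P x"
      using assms i unfolding DG_space_def by blast
    then show ?thesis
      by (intro exI[of _ "smult c P"]) (auto intro: order_trans[OF degree_smult_le])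
  qed
  then show ?thesis
    using assms by (simp add: DG_space_def)
qed

lemma DG_space_diff:
  assumes "f \<in> DG_space k M" "g \<in> DG_space k M"
  shows "(\<lambda>x. f x - g x) \<in> DG_space k M"
  using DG_space_add[OF assms(1) DG_space_cmult[OF assms(2), of "-1"]] by simp

text \<open>A total representative: an interface \<open>i / M\<close> takes the polynomial of the
  cell to its right, and \<open>frac\<close> builds in the period.\<close>

definition piecewise_poly :: "nat \<Rightarrow> (nat \<Rightarrow> real poly) \<Rightarrow> real \<Rightarrow> real" where
  "piecewise_poly M P x = poly (P (nat \<lfloor>real M * frac x\<rfloor>)) (frac x)"

lemma nat_floor_unit_interval:
  assumes "M \<ge> 1" "0 \<le> y" "y < (1::real)"
  shows "nat \<lfloor>real M * y\<rfloor> < M" "real (nat \<lfloor>real M * y\<rfloor>) / real M \<le> y"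
    "y < real (nat \<lfloor>real M * y\<rfloor> + 1) / real M"
proof -
  have ge: "0 \<le> real M * y" and lt: "real M * y < real M"
    using assms by auto
  have eq: "real (nat \<lfloor>real M * y\<rfloor>) = of_int \<lfloor>real M * y\<rfloor>"
    using ge by simp
  have "of_int \<lfloor>real M * y\<rfloor> < real M"
    using lt of_int_floor_le[of "real M * y"] by linarith
  then show "nat \<lfloor>real M * y\<rfloor> < M"
    using eq by (metis of_nat_less_iff)
  show "real (nat \<lfloor>real M * y\<rfloor>) / real M \<le> y"
    using assms eq by (simp add: divide_le_eq mult.commute)
  have "real M * y < of_int \<lfloor>real M * y\<rfloor> + 1"
    by linarith
  then show "y < real (nat \<lfloor>real M * y\<rfloor> + 1) / real M"
    using assms eq by (simp add: less_divide_eq mult.commute add.commute)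
qed

lemma piecewise_poly_cell:
  assumes "i < M" "x \<in> {real i / real M <..< real (i + 1) / real M}"
  shows "piecewise_poly M P x = poly (P i) x"
proof -
  have bounds: "0 \<le> real i / real M" "real (i + 1) / real M \<le> 1"
    using assms(1) by auto
  have x: "0 \<le> x" "x < 1"
    using order_le_less_trans[OF bounds(1)] order_less_le_trans[OF _ bounds(2)] assms(2)
    by (auto simp: less_imp_le simp del: of_nat_add)
  have "real i < real M * x" "real M * x < real i + 1"
    using assms by (auto simp: field_simps)
  then have "\<lfloor>real M * x\<rfloor> = int i"
    by (simp add: floor_eq_iff)
  then show ?thesis
    using x by (simp add: piecewise_poly_def frac_eq_id)
qed

lemma piecewise_poly_DG_space:
  assumes "\<And>i. i < M \<Longrightarrow> degree (P i) \<le> k"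
  shows "piecewise_poly M P \<in> DG_space k M"
proof -
  have "piecewise_poly M P (x + 1) = piecewise_poly M P x" for x
    by (simp add: piecewise_poly_def frac_1_eq)
  then show ?thesis
    using assms piecewise_poly_cell[of _ M _ P] unfolding DG_space_def by blast
qed

lemma DG_space_eq_piecewise_poly:
  assumes "M \<ge> 1" "w \<in> DG_space k M"
  obtains P where "\<And>i. degree (P i) \<le> k"
    "\<And>x. 0 \<le> x \<Longrightarrow> x < 1 \<Longrightarrow> x \<notin> (\<lambda>i. real i / real M) ` {..<M} \<Longrightarrow> w x = piecewise_poly M P x"
proof -
  \<comment> \<open>Indices beyond the last cell receive the zero polynomial, which makes the choice
    of \<open>P\<close> total with a uniform degree bound.\<close>
  have "\<exists>Q :: real poly. degree Q \<le> k \<and>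
      (i < M \<longrightarrow> (\<forall>x\<in>{real i / real M <..< real (i + 1) / real M}. w x = poly Q x))" for i
    using assms(2) unfolding DG_space_def by (cases "i < M") (auto intro: exI[of _ 0])
  then obtain P :: "nat \<Rightarrow> real poly" where P: "\<And>i. degree (P i) \<le> k"
    "\<And>i x. i < M \<Longrightarrow> x \<in> {real i / real M <..< real (i + 1) / real M} \<Longrightarrow> w x = poly (P i) x"
    by metis
  show thesis
  proof (rule that[of P])
    fix x :: real
    assume x: "0 \<le> x" "x < 1" "x \<notin> (\<lambda>i. real i / real M) ` {..<M}"
    define i where "i = nat \<lfloor>real M * x\<rfloor>"
    note i = nat_floor_unit_interval[OF \<open>M \<ge> 1\<close> x(1,2), folded i_def]
    have "real i / real M \<noteq> x"
      using x(3) i(1) by auto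
    with i have "x \<in> {real i / real M <..< real (i + 1) / real M}"
      by auto
    with i(1) show "w x = piecewise_poly M P x"
      by (simp add: P(2) piecewise_poly_cell)
  qed (rule P(1))
qed

lemma piecewise_poly_periodic_bdd:
  assumes "M \<ge> 1"
  shows "piecewise_poly M P \<in> periodic_bdd"
proof -
  \<comment> \<open>As a finite sum of indicators times polynomials in \<open>frac x\<close>, the
    function is visibly measurable, and it is bounded because each polynomial is bounded on
    \<open>{0..1}\<close>.\<close>
  have eq: "piecewise_poly M P x =
      (\<Sum>i<M. indicator {y. \<lfloor>real M * frac y\<rfloor> = int i} x * poly (P i) (frac x))" for x
  proof -
    define j where "j = nat \<lfloor>real M * frac x\<rfloor>"
    have "j < M"
      using nat_floor_unit_interval(1)[OF assms, of "frac x"] frac_lt_1[of x] by (simp add: j_def)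
    moreover have "\<lfloor>real M * frac x\<rfloor> = int i \<longleftrightarrow> i = j" for i
      by (auto simp: j_def)
    ultimately show ?thesis
      by (simp add: piecewise_poly_def indicator_def flip: j_def)
  qed
  have "bounded (poly (P i) ` {0..1})" for i
    by (intro compact_imp_bounded compact_continuous_image continuous_intros) simp
  then have "\<exists>B. \<forall>y\<in>{0..1}. \<bar>poly (P i) y\<bar> \<le> B" for i
    by (simp add: bounded_iff)
  then obtain B where B: "\<And>i y. y \<in> {0..1} \<Longrightarrow> \<bar>poly (P i) y\<bar> \<le> B i"
    by metis
  have B0: "0 \<le> B i" for i
    using B[of 0 i] by simp
  have "\<bar>piecewise_poly M P x\<bar> \<le> (\<Sum>i<M. B i)" for x
  proof -
    have "\<bar>piecewise_poly M P x\<bar>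
        \<le> (\<Sum>i<M. \<bar>indicator {y. \<lfloor>real M * frac y\<rfloor> = int i} x * poly (P i) (frac x)\<bar>)"
      unfolding eq by (rule sum_abs)
    also have "\<dots> \<le> (\<Sum>i<M. B i)"
      using B[of "frac x"] B0 frac_lt_1[of x]
      by (intro sum_mono) (auto simp: indicator_def intro: less_imp_le)
    finally show ?thesis .
  qed
  moreover have "piecewise_poly M P \<in> borel_measurable borel"
  proof -
    have [measurable]: "frac \<in> borel_measurable (borel :: real measure)"
      unfolding frac_def[abs_def] by measurable
    have [measurable]: "poly Q \<in> borel_measurable borel" for Q :: "real poly"
      by (intro borel_measurable_continuous_onI continuous_intros)
    show ?thesis
      unfolding eq[abs_def] by measurable
  qed
  ultimately show ?thesis
    by (intro periodic_bddI) (auto simp: piecewise_poly_def frac_1_eq)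
qed

text \<open>\<open>DG_space\<close> imposes neither measurability nor boundedness. Both hold because
  \<open>w\<close> differs from a \<open>piecewise_poly\<close> by \<open>d\<close>, a finite
  combination of indicators of the periodic translates of the interfaces.\<close>

lemma DG_space_periodic_bdd:
  assumes "M \<ge> 1" "w \<in> DG_space k M"
  shows "w \<in> periodic_bdd"
proof -
  obtain P where P: "\<And>x. 0 \<le> x \<Longrightarrow> x < 1 \<Longrightarrow> x \<notin> (\<lambda>i. real i / real M) ` {..<M} \<Longrightarrow> w x = piecewise_poly M P x"
    using DG_space_eq_piecewise_poly[OF assms] by metis
  define S where "S = (\<lambda>i. real i / real M) ` {..<M}"
  define d where "d = (\<lambda>x. \<Sum>s\<in>S. (w s - piecewise_poly M P s) * indicator {y. frac y = s} x)"
  have fin: "finite S"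
    by (simp add: S_def)
  have "d \<in> periodic_bdd"
  proof (rule periodic_bddI)
    have [measurable]: "frac \<in> borel_measurable (borel :: real measure)"
      unfolding frac_def[abs_def] by measurable
    show "d \<in> borel_measurable borel"
      unfolding d_def by measurable
    show "\<bar>d x\<bar> \<le> (\<Sum>s\<in>S. \<bar>w s - piecewise_poly M P s\<bar>)" for x
      unfolding d_def by (intro order_trans[OF sum_abs] sum_mono) (auto simp: indicator_def)
    show "d (x + 1) = d x" for x
      by (simp add: d_def indicator_def frac_1_eq)
  qed
  moreover have "w x = piecewise_poly M P x + d x" for x
  proof -
    have "d x = (if frac x \<in> S then w (frac x) - piecewise_poly M P (frac x) else 0)"
      using fin by (simp add: d_def indicator_def if_distrib[of "\<lambda>c. _ * c"] cong: if_cong)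
    moreover have "w (frac x) = w x" "piecewise_poly M P (frac x) = piecewise_poly M P x"
      using periodic_frac[of w x] assms(2) by (auto simp: DG_space_periodic piecewise_poly_def frac_eq_id frac_lt_1)
    ultimately show ?thesis
      using P[of "frac x"] frac_lt_1[of x] by (auto simp: S_def)
  qed
  then have "w = (\<lambda>x. piecewise_poly M P x + d x)"
    by blast
  ultimately show ?thesis
    using periodic_bdd_add piecewise_poly_periodic_bdd[OF assms(1)] by metis
qed

text \<open>
  The second conjunct says that the projection lies in the span of \<open>A\<close>, expressed by duality; it
  makes the induction (Gram--Schmidt) go through without a vector space structure on functions.
\<close>

lemma finite_projection:
  assumes "finite A" "A \<subseteq> V" "V \<subseteq> periodic_bdd" "f \<in> periodic_bdd"
    and zero: "(\<lambda>x. 0) \<in> V"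
    and add: "\<And>u w. u \<in> V \<Longrightarrow> w \<in> V \<Longrightarrow> (\<lambda>x. u x + w x) \<in> V"
    and cmult: "\<And>c u. u \<in> V \<Longrightarrow> (\<lambda>x. c * u x) \<in> V"
  shows "\<exists>g\<in>V. (\<forall>w\<in>A. L2_inner (\<lambda>x. f x - g x) w = 0) \<and>
    (\<forall>r\<in>periodic_bdd. (\<forall>w\<in>A. L2_inner r w = 0) \<longrightarrow> L2_inner r g = 0)"
  using assms(1,2,4)
proof (induction A arbitrary: f rule: finite_induct)
  case empty
  have "L2_inner r (\<lambda>x. 0) = 0" for r
    using L2_inner_cmult_right[of r 0 "\<lambda>x. 0"] by simp
  with zero show ?case
    by auto
next
  case (insert b A)
  have V: "u \<in> V \<Longrightarrow> u \<in> periodic_bdd" for u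
    using assms(3) by blast
  have b: "b \<in> V" "A \<subseteq> V"
    using insert.prems by auto
  obtain gb where gb: "gb \<in> V" "\<forall>w\<in>A. L2_inner (\<lambda>x. b x - gb x) w = 0"
    "\<forall>r\<in>periodic_bdd. (\<forall>w\<in>A. L2_inner r w = 0) \<longrightarrow> L2_inner r gb = 0"
    using insert.IH[OF b(2) V[OF b(1)]] by blast
  obtain g0 where g0: "g0 \<in> V" "\<forall>w\<in>A. L2_inner (\<lambda>x. f x - g0 x) w = 0"
    "\<forall>r\<in>periodic_bdd. (\<forall>w\<in>A. L2_inner r w = 0) \<longrightarrow> L2_inner r g0 = 0"
    using insert.IH[OF b(2) insert.prems(2)] by blast
  \<comment> \<open>\<open>e\<close> is the part of \<open>b\<close> orthogonal to \<open>A\<close>;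
    the new projection is the old one plus the component along \<open>e\<close>.\<close>
  define e where "e = (\<lambda>x. b x - gb x)"
  define c where "c = L2_inner (\<lambda>x. f x - g0 x) e / L2_inner e e"
  define g where "g = (\<lambda>x. g0 x + c * e x)"
  have "(\<lambda>x. b x + (-1) * gb x) \<in> V"
    by (intro add cmult b gb)
  then have e: "e \<in> V"
    by (simp add: e_def)
  have g: "g \<in> V"
    unfolding g_def by (intro add cmult g0 e)
  note pb = V[OF b(1)] V[OF gb(1)] V[OF g0(1)] V[OF e] V[OF g] insert.prems(2)
  have inner_g: "L2_inner (\<lambda>x. f x - g x) w = L2_inner (\<lambda>x. f x - g0 x) w - c * L2_inner e w"
    if "w \<in> periodic_bdd" for w
    using that pb
    by (simp add: g_def L2_inner_diff_left L2_inner_add_left L2_inner_cmult_left periodic_bdd_add periodic_bdd_diff periodic_bdd_cmult)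
  have orth: "L2_inner (\<lambda>x. f x - g x) w = 0" if "w \<in> A" for w
  proof -
    have "w \<in> periodic_bdd"
      using that b(2) V by blast
    then show ?thesis
      using that gb(2) g0(2) by (simp add: inner_g flip: e_def)
  qed
  \<comment> \<open>If \<open>b\<close> depends on \<open>A\<close>, then \<open>e\<close> has norm
    zero and the left-hand side vanishes by Cauchy-Schwarz, so \<open>A\<close> may be linearly
    dependent.\<close>
  have ce: "L2_inner (\<lambda>x. f x - g0 x) e = c * L2_inner e e"
  proof (cases "L2_inner e e = 0")
    case True
    then show ?thesis
      using L2_inner_square_le[of "\<lambda>x. f x - g0 x" e] pb by (simp add: periodic_bdd_diff)
  qed (simp add: c_def)
  \<comment> \<open>The duality clause for \<open>gb\<close> turns orthogonality to \<open>A\<close>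
    into orthogonality to \<open>gb\<close>; with orthogonality to \<open>e\<close> this covers
    \<open>b = gb + e\<close>.\<close>
  have "L2_inner (\<lambda>x. f x - g x) gb = 0"
    using gb(3) orth pb by (simp add: periodic_bdd_diff)
  moreover have "L2_inner (\<lambda>x. f x - g x) e = L2_inner (\<lambda>x. f x - g x) b - L2_inner (\<lambda>x. f x - g x) gb"
    unfolding e_def using pb by (simp add: L2_inner_diff_right periodic_bdd_diff)
  ultimately have "L2_inner (\<lambda>x. f x - g x) b = 0"
    using ce pb by (simp add: inner_g)
  moreover have "L2_inner r g = 0" if "r \<in> periodic_bdd" "\<forall>w\<in>insert b A. L2_inner r w = 0" for r
    using that gb(3) g0(3) pb
    by (simp add: g_def e_def L2_inner_add_right L2_inner_cmult_right L2_inner_diff_right periodic_bdd_add periodic_bdd_diff periodic_bdd_cmult)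
  ultimately show ?case
    using g orth by auto
qed

definition DG_basis :: "nat \<Rightarrow> nat \<Rightarrow> nat \<Rightarrow> real \<Rightarrow> real" where
  "DG_basis M i j = piecewise_poly M (\<lambda>l. if l = i then monom 1 j else 0)"

lemma DG_basis_DG_space: "j \<le> k \<Longrightarrow> DG_basis M i j \<in> DG_space k M"
  unfolding DG_basis_def by (rule piecewise_poly_DG_space) (auto intro: order_trans[OF degree_monom_le])

lemma piecewise_poly_expansion:
  assumes "M \<ge> 1" "\<And>i. degree (P i) \<le> k"
  shows "piecewise_poly M P x = (\<Sum>i<M. \<Sum>j\<le>k. coeff (P i) j * DG_basis M i j x)"
proof -
  define l where "l = nat \<lfloor>real M * frac x\<rfloor>"
  have l: "l < M"
    using nat_floor_unit_interval(1)[OF assms(1), of "frac x"] frac_lt_1[of x] by (simp add: l_def)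
  have "(\<Sum>i<M. \<Sum>j\<le>k. coeff (P i) j * DG_basis M i j x)
      = (\<Sum>i<M. if l = i then \<Sum>j\<le>k. coeff (P i) j * frac x ^ j else 0)"
    by (intro sum.cong refl) (auto simp: DG_basis_def piecewise_poly_def poly_monom simp flip: l_def)
  also have "\<dots> = (\<Sum>j\<le>k. coeff (P l) j * frac x ^ j)"
    using l by simp
  also have "\<dots> = poly (P l) (frac x)"
    unfolding poly_altdef using assms(2)[of l]
    by (intro sum.mono_neutral_right) (auto simp: coeff_eq_0)
  finally show ?thesis
    by (simp add: piecewise_poly_def l_def)
qed

lemma periodic_bdd_sum:
  "finite A \<Longrightarrow> (\<And>i. i \<in> A \<Longrightarrow> F i \<in> periodic_bdd) \<Longrightarrow> (\<lambda>x. \<Sum>i\<in>A. F i x) \<in> periodic_bdd"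
proof (induction A rule: finite_induct)
  case empty
  then show ?case
    by (simp add: periodic_bdd_const)
qed (simp add: periodic_bdd_add)

lemma L2_inner_sum_right:
  assumes "finite A" "f \<in> periodic_bdd" "\<And>i. i \<in> A \<Longrightarrow> F i \<in> periodic_bdd"
  shows "L2_inner f (\<lambda>x. \<Sum>i\<in>A. F i x) = (\<Sum>i\<in>A. L2_inner f (F i))"
  using assms(1,3)
proof (induction A rule: finite_induct)
  case empty
  then show ?case
    using L2_inner_cmult_right[of f 0 "\<lambda>x. 0"] by simp
next
  case (insert i A)
  then have "F i \<in> periodic_bdd" "(\<lambda>x. \<Sum>i\<in>A. F i x) \<in> periodic_bdd"
    using periodic_bdd_sum[of A F] by auto
  with insert show ?case
    by (simp add: L2_inner_add_right assms(2))
qed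

lemma DG_proj_exists:
  assumes M: "M \<ge> 1" and f: "f \<in> periodic_bdd"
  shows "\<exists>g. g \<in> DG_space k M \<and> (\<forall>w\<in>DG_space k M. L2_inner (\<lambda>x. f x - g x) w = 0)"
proof -
  define A where "A = (\<lambda>(i, j). DG_basis M i j) ` ({..<M} \<times> {..k})"
  have "finite A" "A \<subseteq> DG_space k M"
    by (auto simp: A_def DG_basis_DG_space)
  moreover have "DG_space k M \<subseteq> periodic_bdd"
    using DG_space_periodic_bdd[OF M] by blast
  moreover note f
  moreover note DG_space_zero[of k M]
  ultimately have "\<exists>g\<in>DG_space k M. (\<forall>w\<in>A. L2_inner (\<lambda>x. f x - g x) w = 0) \<and>
      (\<forall>r\<in>periodic_bdd. (\<forall>w\<in>A. L2_inner r w = 0) \<longrightarrow> L2_inner r g = 0)"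
    by (rule finite_projection) (rule DG_space_add DG_space_cmult, assumption+)+
  then obtain g where g: "g \<in> DG_space k M" "\<And>w. w \<in> A \<Longrightarrow> L2_inner (\<lambda>x. f x - g x) w = 0"
    by blast
  have r: "(\<lambda>x. f x - g x) \<in> periodic_bdd"
    using f g(1) M by (simp add: periodic_bdd_diff DG_space_periodic_bdd)
  \<comment> \<open>\<open>A\<close> spans \<open>DG_space\<close> only up to interface values, so
    \<open>w\<close> is replaced by its representative before it is expanded in the basis.\<close>
  have "L2_inner (\<lambda>x. f x - g x) w = 0" if w: "w \<in> DG_space k M" for w
  proof -
    obtain P where P: "\<And>i. degree (P i) \<le> k"
      "\<And>x. 0 \<le> x \<Longrightarrow> x < 1 \<Longrightarrow> x \<notin> (\<lambda>i. real i / real M) ` {..<M} \<Longrightarrow> w x = piecewise_poly M P x"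
      using DG_space_eq_piecewise_poly[OF M w] by metis
    have basis: "DG_basis M i j \<in> periodic_bdd" for i j
      using M by (simp add: DG_basis_def piecewise_poly_periodic_bdd)
    have "L2_inner (\<lambda>x. f x - g x) w = L2_inner (\<lambda>x. f x - g x) (piecewise_poly M P)"
      using P(2) M w r
      by (intro L2_inner_cong_finite[of "(\<lambda>i. real i / real M) ` {..<M}"])
        (auto simp: piecewise_poly_periodic_bdd DG_space_periodic_bdd)
    also have "\<dots> = (\<Sum>i<M. \<Sum>j\<le>k. coeff (P i) j * L2_inner (\<lambda>x. f x - g x) (DG_basis M i j))"
      unfolding piecewise_poly_expansion[OF M P(1)]
      using r basis
      by (simp add: L2_inner_sum_right periodic_bdd_sum periodic_bdd_cmult L2_inner_cmult_right)
    also have "\<dots> = 0"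
      using g(2) by (intro sum.neutral ballI) (force simp: A_def)
    finally show ?thesis .
  qed
  with g(1) show ?thesis
    by blast
qed

section \<open>Contraction and best approximation by the projection\<close>

lemma DG_proj:
  assumes "M \<ge> 1" "f \<in> periodic_bdd"
  shows "DG_proj k M f \<in> DG_space k M"
    and "w \<in> DG_space k M \<Longrightarrow> L2_inner (\<lambda>x. f x - DG_proj k M f x) w = 0"
  using someI_ex[OF DG_proj_exists[OF assms, of k]] by (auto simp: DG_proj_def)

lemma DG_proj_periodic_bdd:
  assumes "M \<ge> 1" "f \<in> periodic_bdd"
  shows "DG_proj k M f \<in> periodic_bdd"
  using DG_proj(1)[OF assms] DG_space_periodic_bdd[OF assms(1)] by blast

text \<open>Cauchy-Schwarz with one factor cancelled; the orthogonality relations of the projection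
  are used in this form.\<close>

lemma L2_norm01_le_of_inner:
  assumes "f \<in> periodic_bdd" "g \<in> periodic_bdd" "L2_inner f f = L2_inner f g"
  shows "L2_norm01 f \<le> L2_norm01 g"
proof -
  have "L2_norm01 f * L2_norm01 f \<le> L2_norm01 f * L2_norm01 g"
    using L2_inner_le_norm[OF assms(1,2)] L2_norm01_square[of f] assms(3) by (simp add: power2_eq_square)
  then show ?thesis
    using L2_norm01_nonneg[of f] L2_norm01_nonneg[of g] by (cases "L2_norm01 f = 0") auto
qed

text \<open>The difference \<open>d\<close> of the projections lies in \<open>DG_space\<close>, so
  both residuals are orthogonal to it. A difference is estimated because \<open>DG_proj\<close>
  commutes with subtraction only up to interface values.\<close>

lemma DG_proj_nonexpansive:
  assumes M: "M \<ge> 1" and f: "f \<in> periodic_bdd" and g: "g \<in> periodic_bdd"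
  shows "L2_norm01 (\<lambda>x. DG_proj k M f x - DG_proj k M g x) \<le> L2_norm01 (\<lambda>x. f x - g x)"
proof (rule L2_norm01_le_of_inner)
  note Pf = DG_proj[OF M f, where k = k] DG_proj_periodic_bdd[OF M f, of k]
  note Pg = DG_proj[OF M g, where k = k] DG_proj_periodic_bdd[OF M g, of k]
  define d where "d = (\<lambda>x. DG_proj k M f x - DG_proj k M g x)"
  have d: "d \<in> DG_space k M" "d \<in> periodic_bdd"
    unfolding d_def using Pf(1) Pg(1) Pf(3) Pg(3) by (auto intro: DG_space_diff periodic_bdd_diff)
  have "L2_inner (\<lambda>x. f x - DG_proj k M f x) d = 0" "L2_inner (\<lambda>x. g x - DG_proj k M g x) d = 0"
    using Pf(2) Pg(2) d(1) by auto
  then have "L2_inner d d = L2_inner (\<lambda>x. f x - g x) d"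
    using f g Pf(3) Pg(3) d(2) unfolding d_def[symmetric]
    by (subst (1) d_def) (simp add: L2_inner_diff_left)
  then show "L2_inner d d = L2_inner d (\<lambda>x. f x - g x)"
    by (simp add: L2_inner_commute)
  show "d \<in> periodic_bdd"
    by (rule d)
qed (use f g in \<open>rule periodic_bdd_diff\<close>)

text \<open>The residual is orthogonal both to the projection and to \<open>w\<close>, so either may
  be subtracted from \<open>f\<close> in its inner product with the residual.\<close>

lemma DG_proj_best:
  assumes M: "M \<ge> 1" and f: "f \<in> periodic_bdd" and w: "w \<in> DG_space k M"
  shows "L2_norm01 (\<lambda>x. f x - DG_proj k M f x) \<le> L2_norm01 (\<lambda>x. f x - w x)"
proof (rule L2_norm01_le_of_inner)
  note Pf = DG_proj[OF M f, where k = k] DG_proj_periodic_bdd[OF M f, of k]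
  have wp: "w \<in> periodic_bdd"
    using DG_space_periodic_bdd[OF M w] .
  define d where "d = (\<lambda>x. f x - DG_proj k M f x)"
  show d: "d \<in> periodic_bdd"
    unfolding d_def using f Pf(3) by (rule periodic_bdd_diff)
  show "L2_inner d d = L2_inner d (\<lambda>x. f x - w x)"
    using Pf(2)[OF Pf(1)] Pf(2)[OF w] f wp Pf(3) d unfolding d_def[symmetric]
    by (subst (2) d_def) (simp add: L2_inner_diff_right)
qed (use f DG_space_periodic_bdd[OF M w] in \<open>rule periodic_bdd_diff\<close>)

section \<open>Stability of the schemes\<close>

abbreviation (input) L2_dist :: "(real \<Rightarrow> real) \<Rightarrow> (real \<Rightarrow> real) \<Rightarrow> real" where
  "L2_dist f g \<equiv> L2_norm01 (\<lambda>x. f x - g x)"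

lemma L2_dist_triangle:
  assumes "f \<in> periodic_bdd" "g \<in> periodic_bdd" "h \<in> periodic_bdd"
  shows "L2_dist f h \<le> L2_dist f g + L2_dist g h"
  using L2_norm01_triangle[of "\<lambda>x. f x - g x" "\<lambda>x. g x - h x"] assms by (simp add: periodic_bdd_diff)

lemma L2_norm01_sum:
  assumes "finite A" "\<And>i. i \<in> A \<Longrightarrow> F i \<in> periodic_bdd"
  shows "L2_norm01 (\<lambda>x. \<Sum>i\<in>A. F i x) \<le> (\<Sum>i\<in>A. L2_norm01 (F i))"
  using assms
proof (induction A rule: finite_induct)
  case empty
  then show ?case
    by (simp add: L2_norm01_le_bound periodic_bdd_const)
next
  case (insert i A)
  then have "L2_norm01 (\<lambda>x. F i x + (\<Sum>i\<in>A. F i x)) \<le> L2_norm01 (F i) + L2_norm01 (\<lambda>x. \<Sum>i\<in>A. F i x)"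
    using periodic_bdd_sum[of A F] by (intro L2_norm01_triangle) auto
  with insert show ?case
    by force
qed

lemma L2_dist_sum:
  assumes "finite A" "\<And>i. i \<in> A \<Longrightarrow> F i \<in> periodic_bdd" "\<And>i. i \<in> A \<Longrightarrow> G i \<in> periodic_bdd"
    and "\<And>i. i \<in> A \<Longrightarrow> 0 \<le> c i"
  shows "L2_dist (\<lambda>x. \<Sum>i\<in>A. c i * F i x) (\<lambda>x. \<Sum>i\<in>A. c i * G i x)
    \<le> (\<Sum>i\<in>A. c i * L2_dist (F i) (G i))"
proof -
  have "L2_dist (\<lambda>x. \<Sum>i\<in>A. c i * F i x) (\<lambda>x. \<Sum>i\<in>A. c i * G i x)
      = L2_norm01 (\<lambda>x. \<Sum>i\<in>A. c i * (F i x - G i x))"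
    by (simp add: sum_subtractf right_diff_distrib)
  also have "\<dots> \<le> (\<Sum>i\<in>A. L2_norm01 (\<lambda>x. c i * (F i x - G i x)))"
    using assms(1-3) by (intro L2_norm01_sum periodic_bdd_cmult periodic_bdd_diff)
  also have "\<dots> = (\<Sum>i\<in>A. c i * L2_dist (F i) (G i))"
    using assms(4) by (intro sum.cong refl) (simp add: L2_norm01_cmult)
  finally show ?thesis .
qed

text \<open>
  All translates are required, because \<open>DG_space\<close> itself is not translation invariant, while the
  schemes are built from translations.
\<close>

definition DG_approx :: "nat \<Rightarrow> nat \<Rightarrow> real \<Rightarrow> (real \<Rightarrow> real) \<Rightarrow> bool" where
  "DG_approx k M \<eta> f \<longleftrightarrow> f \<in> periodic_bdd \<and>
     (\<forall>a. \<exists>w\<in>DG_space k M. L2_dist (\<lambda>x. f (x + a)) w \<le> \<eta>)"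

lemma DG_approx_periodic_bdd: "DG_approx k M \<eta> f \<Longrightarrow> f \<in> periodic_bdd"
  by (simp add: DG_approx_def)

lemma DG_approx_shift:
  assumes "DG_approx k M \<eta> f"
  shows "DG_approx k M \<eta> (\<lambda>x. f (x + b))"
  using assms unfolding DG_approx_def by (auto simp: periodic_bdd_shift add.assoc)

lemma DG_space_sum:
  "finite A \<Longrightarrow> (\<And>i. i \<in> A \<Longrightarrow> F i \<in> DG_space k M) \<Longrightarrow> (\<lambda>x. \<Sum>i\<in>A. F i x) \<in> DG_space k M"
  by (induction A rule: finite_induct) (auto simp: DG_space_zero DG_space_add)

text \<open>The approximants are combined with the same weights, and \<open>\<eta>\<close> does not
  grow because these sum to 1.\<close>

lemma DG_approx_convex:
  assumes M: "M \<ge> 1" and A: "finite A" "\<And>i. i \<in> A \<Longrightarrow> DG_approx k M \<eta> (F i)"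
    and c: "\<And>i. i \<in> A \<Longrightarrow> 0 \<le> c i" "sum c A = 1"
  shows "DG_approx k M \<eta> (\<lambda>x. \<Sum>i\<in>A. c i * F i x)"
  unfolding DG_approx_def
proof (intro conjI allI)
  show "(\<lambda>x. \<Sum>i\<in>A. c i * F i x) \<in> periodic_bdd"
    using A by (intro periodic_bdd_sum periodic_bdd_cmult) (auto dest: DG_approx_periodic_bdd)
  fix a
  have "\<forall>i\<in>A. \<exists>w\<in>DG_space k M. L2_dist (\<lambda>x. F i (x + a)) w \<le> \<eta>"
    using A(2) by (simp add: DG_approx_def)
  then obtain w where w: "\<And>i. i \<in> A \<Longrightarrow> w i \<in> DG_space k M"
    "\<And>i. i \<in> A \<Longrightarrow> L2_dist (\<lambda>x. F i (x + a)) (w i) \<le> \<eta>"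
    by metis
  have "L2_dist (\<lambda>x. \<Sum>i\<in>A. c i * F i (x + a)) (\<lambda>x. \<Sum>i\<in>A. c i * w i x)
      \<le> (\<Sum>i\<in>A. c i * L2_dist (\<lambda>x. F i (x + a)) (w i))"
    using A c(1) DG_space_periodic_bdd[OF M w(1)]
    by (intro L2_dist_sum periodic_bdd_shift) (auto dest: DG_approx_periodic_bdd)
  also have "\<dots> \<le> (\<Sum>i\<in>A. c i * \<eta>)"
    using w(2) c(1) by (intro sum_mono mult_left_mono) auto
  also have "\<dots> = \<eta>"
    by (simp add: c(2) flip: sum_distrib_right)
  finally have "L2_dist (\<lambda>x. \<Sum>i\<in>A. c i * F i (x + a)) (\<lambda>x. \<Sum>i\<in>A. c i * w i x) \<le> \<eta>" .
  moreover have "(\<lambda>x. \<Sum>i\<in>A. c i * w i x) \<in> DG_space k M"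
    using A(1) w(1) by (intro DG_space_sum DG_space_cmult)
  ultimately show "\<exists>w\<in>DG_space k M. L2_dist (\<lambda>x. \<Sum>i\<in>A. c i * F i (x + a)) w \<le> \<eta>"
    by (rule bexI)
qed

section \<open>The averaging operator, its projected version and their powers\<close>

lemma S0_op_eq_sum:
  "S0_op \<sigma> \<tau> u = (\<lambda>x. \<Sum>e\<in>{-1, 1::real}. 1/2 * u (x + e * (\<sigma> * sqrt \<tau>)))"
  by (auto simp: S0_op_def)

lemma S0_op_periodic_bdd:
  assumes "u \<in> periodic_bdd"
  shows "S0_op \<sigma> \<tau> u \<in> periodic_bdd"
  unfolding S0_op_eq_sum using assms by (intro periodic_bdd_sum periodic_bdd_cmult periodic_bdd_shift) auto

lemma S0_op_DG_approx:
  assumes "M \<ge> 1" "DG_approx k M \<eta> f"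
  shows "DG_approx k M \<eta> (S0_op \<sigma> \<tau> f)"
  unfolding S0_op_eq_sum using assms by (intro DG_approx_convex DG_approx_shift) auto

lemma S0_op_nonexpansive:
  assumes "f \<in> periodic_bdd" "g \<in> periodic_bdd"
  shows "L2_dist (S0_op \<sigma> \<tau> f) (S0_op \<sigma> \<tau> g) \<le> L2_dist f g"
proof -
  have "L2_dist (S0_op \<sigma> \<tau> f) (S0_op \<sigma> \<tau> g)
    \<le> (\<Sum>e\<in>{-1, 1::real}. 1/2 * L2_dist (\<lambda>x. f (x + e * (\<sigma> * sqrt \<tau>))) (\<lambda>x. g (x + e * (\<sigma> * sqrt \<tau>))))"
    unfolding S0_op_eq_sum using assms by (intro L2_dist_sum periodic_bdd_shift) auto
  also have "\<dots> = L2_dist f g"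
    using L2_norm01_shift[OF periodic_bdd_diff[OF assms]] by simp
  finally show ?thesis .
qed

lemma S_op_periodic_bdd:
  "M \<ge> 1 \<Longrightarrow> u \<in> periodic_bdd \<Longrightarrow> S_op k M \<sigma> \<tau> u \<in> periodic_bdd"
  by (simp add: S_op_def DG_proj_periodic_bdd S0_op_periodic_bdd)

text \<open>The projection of \<open>f\<close> is inserted between the two functions. The
  approximation error is thus charged to \<open>f\<close> alone; \<open>g\<close>, in the
  application built from the discontinuous numerical solution, enters only through
  contraction.\<close>

lemma DG_proj_dist:
  assumes M: "M \<ge> 1" and f: "DG_approx k M \<eta> f" and g: "g \<in> periodic_bdd"
  shows "L2_dist f (DG_proj k M g) \<le> L2_dist f g + \<eta>"
proof -
  have fp: "f \<in> periodic_bdd"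
    using f by (rule DG_approx_periodic_bdd)
  have "\<exists>w\<in>DG_space k M. L2_dist (\<lambda>x. f (x + 0)) w \<le> \<eta>"
    using f unfolding DG_approx_def by blast
  then obtain w where "w \<in> DG_space k M" "L2_dist f w \<le> \<eta>"
    by auto
  then have "L2_dist f (DG_proj k M f) \<le> \<eta>"
    using DG_proj_best[OF M fp] by fastforce
  then show ?thesis
    using L2_dist_triangle[of f "DG_proj k M f" "DG_proj k M g"] DG_proj_nonexpansive[OF M fp g, of k]
      DG_proj_periodic_bdd[OF M, of _ k] fp g by fastforce
qed

lemma S0_op_funpow_periodic_bdd: "u \<in> periodic_bdd \<Longrightarrow> (S0_op \<sigma> \<tau> ^^ l) u \<in> periodic_bdd"
  by (induction l) (auto simp: S0_op_periodic_bdd)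

lemma S_op_funpow_periodic_bdd:
  "M \<ge> 1 \<Longrightarrow> u \<in> periodic_bdd \<Longrightarrow> (S_op k M \<sigma> \<tau> ^^ l) u \<in> periodic_bdd"
  by (induction l) (auto simp: S_op_periodic_bdd)

lemma S0_op_funpow_DG_approx:
  "M \<ge> 1 \<Longrightarrow> DG_approx k M \<eta> f \<Longrightarrow> DG_approx k M \<eta> ((S0_op \<sigma> \<tau> ^^ l) f)"
  by (induction l) (auto simp: S0_op_DG_approx)

lemma S0_op_funpow_nonexpansive:
  assumes "f \<in> periodic_bdd" "g \<in> periodic_bdd"
  shows "L2_dist ((S0_op \<sigma> \<tau> ^^ l) f) ((S0_op \<sigma> \<tau> ^^ l) g) \<le> L2_dist f g"
proof (induction l)
  case (Suc l)
  then show ?case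
    using S0_op_nonexpansive[OF assms[THEN S0_op_funpow_periodic_bdd[where \<sigma> = \<sigma> and \<tau> = \<tau> and l = l]], where \<sigma> = \<sigma> and \<tau> = \<tau>] by simp
qed simp

text \<open>Each power costs one projection error \<open>\<eta>\<close>, since the iterates of
  \<open>f\<close> under \<open>S0_op\<close> stay approximable with the same
  \<open>\<eta>\<close>.\<close>

lemma S_op_funpow_dist:
  assumes M: "M \<ge> 1" and f: "DG_approx k M \<eta> f" and u: "u \<in> periodic_bdd"
  shows "L2_dist ((S0_op \<sigma> \<tau> ^^ l) f) ((S_op k M \<sigma> \<tau> ^^ l) u) \<le> L2_dist f u + real l * \<eta>"
proof (induction l)
  case (Suc l)
  have f': "DG_approx k M \<eta> ((S0_op \<sigma> \<tau> ^^ l) f)"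
    using M f by (rule S0_op_funpow_DG_approx)
  have u': "(S_op k M \<sigma> \<tau> ^^ l) u \<in> periodic_bdd"
    using M u by (rule S_op_funpow_periodic_bdd)
  have "L2_dist (S0_op \<sigma> \<tau> ((S0_op \<sigma> \<tau> ^^ l) f)) (S_op k M \<sigma> \<tau> ((S_op k M \<sigma> \<tau> ^^ l) u))
      \<le> L2_dist (S0_op \<sigma> \<tau> ((S0_op \<sigma> \<tau> ^^ l) f)) (S0_op \<sigma> \<tau> ((S_op k M \<sigma> \<tau> ^^ l) u)) + \<eta>"
    unfolding S_op_def[of k M \<sigma> \<tau> "(S_op k M \<sigma> \<tau> ^^ l) u"]
    using M f' u' by (intro DG_proj_dist S0_op_DG_approx S0_op_periodic_bdd)
  also have "\<dots> \<le> L2_dist ((S0_op \<sigma> \<tau> ^^ l) f) ((S_op k M \<sigma> \<tau> ^^ l) u) + \<eta>"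
    using S0_op_nonexpansive[OF DG_approx_periodic_bdd[OF f'] u'] by simp
  finally show ?case
    using Suc by (simp add: algebra_simps)
qed simp

text \<open>A polynomial in an operator. With \<open>S_op\<close> it is the scheme; with
  \<open>S0_op\<close> it is the projection-free reference and, projected once, the variant.\<close>

definition op_comb ::
    "nat \<Rightarrow> (nat \<Rightarrow> real) \<Rightarrow> ((real \<Rightarrow> real) \<Rightarrow> real \<Rightarrow> real) \<Rightarrow> (real \<Rightarrow> real) \<Rightarrow> real \<Rightarrow> real" where
  "op_comb m c A u = (\<lambda>x. \<Sum>l\<le>m. c l * (A ^^ l) u x)"

lemma op_comb_S_op_step:
  assumes M: "M \<ge> 1" and c: "\<And>l. l \<le> m \<Longrightarrow> 0 \<le> c l" "sum c {..m} = 1" and \<eta>: "0 \<le> \<eta>"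
    and f: "DG_approx k M \<eta> f" and u: "u \<in> periodic_bdd"
  shows "op_comb m c (S_op k M \<sigma> \<tau>) u \<in> periodic_bdd"
    and "L2_dist (op_comb m c (S0_op \<sigma> \<tau>) f) (op_comb m c (S_op k M \<sigma> \<tau>) u) \<le> L2_dist f u + real m * \<eta>"
proof -
  note fp = DG_approx_periodic_bdd[OF f]
  show "op_comb m c (S_op k M \<sigma> \<tau>) u \<in> periodic_bdd"
    unfolding op_comb_def using M u by (intro periodic_bdd_sum periodic_bdd_cmult S_op_funpow_periodic_bdd) auto
  have "L2_dist (op_comb m c (S0_op \<sigma> \<tau>) f) (op_comb m c (S_op k M \<sigma> \<tau>) u)
      \<le> (\<Sum>l\<le>m. c l * L2_dist ((S0_op \<sigma> \<tau> ^^ l) f) ((S_op k M \<sigma> \<tau> ^^ l) u))"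
    unfolding op_comb_def using M u fp c(1)
    by (intro L2_dist_sum S_op_funpow_periodic_bdd S0_op_funpow_periodic_bdd) auto
  also have "\<dots> \<le> (\<Sum>l\<le>m. c l * (L2_dist f u + real m * \<eta>))"
  proof (intro sum_mono mult_left_mono)
    fix l assume "l \<in> {..m}"
    then have "real l * \<eta> \<le> real m * \<eta>"
      using \<eta> by (intro mult_right_mono) auto
    then show "L2_dist ((S0_op \<sigma> \<tau> ^^ l) f) ((S_op k M \<sigma> \<tau> ^^ l) u) \<le> L2_dist f u + real m * \<eta>"
      using S_op_funpow_dist[OF M f u, where \<sigma> = \<sigma> and \<tau> = \<tau> and l = l] by simp
  qed (use c(1) in auto)
  also have "\<dots> = L2_dist f u + real m * \<eta>"
    by (simp add: c(2) flip: sum_distrib_right)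
  finally show "L2_dist (op_comb m c (S0_op \<sigma> \<tau>) f) (op_comb m c (S_op k M \<sigma> \<tau>) u) \<le> L2_dist f u + real m * \<eta>" .
qed

lemma DG_proj_op_comb_step:
  assumes M: "M \<ge> 1" and c: "\<And>l. l \<le> m \<Longrightarrow> 0 \<le> c l" "sum c {..m} = 1"
    and f: "DG_approx k M \<eta> f" and u: "u \<in> periodic_bdd"
  shows "DG_proj k M (op_comb m c (S0_op \<sigma> \<tau>) u) \<in> periodic_bdd"
    and "L2_dist (op_comb m c (S0_op \<sigma> \<tau>) f) (DG_proj k M (op_comb m c (S0_op \<sigma> \<tau>) u)) \<le> L2_dist f u + \<eta>"
proof -
  note fp = DG_approx_periodic_bdd[OF f]
  have Qu: "op_comb m c (S0_op \<sigma> \<tau>) u \<in> periodic_bdd"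
    unfolding op_comb_def using M u by (intro periodic_bdd_sum periodic_bdd_cmult S0_op_funpow_periodic_bdd) auto
  then show "DG_proj k M (op_comb m c (S0_op \<sigma> \<tau>) u) \<in> periodic_bdd"
    by (rule DG_proj_periodic_bdd[OF M])
  have Qf: "DG_approx k M \<eta> (op_comb m c (S0_op \<sigma> \<tau>) f)"
    unfolding op_comb_def using M c f by (intro DG_approx_convex S0_op_funpow_DG_approx) auto
  have "L2_dist (op_comb m c (S0_op \<sigma> \<tau>) f) (op_comb m c (S0_op \<sigma> \<tau>) u)
      \<le> (\<Sum>l\<le>m. c l * L2_dist ((S0_op \<sigma> \<tau> ^^ l) f) ((S0_op \<sigma> \<tau> ^^ l) u))"
    unfolding op_comb_def using u fp c(1)
    by (intro L2_dist_sum S0_op_funpow_periodic_bdd) auto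
  also have "\<dots> \<le> (\<Sum>l\<le>m. c l * L2_dist f u)"
    using c(1) u fp by (intro sum_mono mult_left_mono S0_op_funpow_nonexpansive) auto
  also have "\<dots> = L2_dist f u"
    by (simp add: c(2) flip: sum_distrib_right)
  finally show "L2_dist (op_comb m c (S0_op \<sigma> \<tau>) f) (DG_proj k M (op_comb m c (S0_op \<sigma> \<tau>) u)) \<le> L2_dist f u + \<eta>"
    using DG_proj_dist[OF M Qf Qu] by simp
qed

text \<open>The intermediate point \<open>Q (V n)\<close> separates the consistency error
  \<open>\<delta>\<close> from the projection error \<open>c\<close>. The previous error enters with
  factor 1, so the contributions merely add up.\<close>

lemma scheme_error:
  assumes F: "\<And>f u. DG_approx k M \<eta> f \<Longrightarrow> u \<in> periodic_bdd \<Longrightarrow>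
      F u \<in> periodic_bdd \<and> L2_dist (Q f) (F u) \<le> L2_dist f u + c"
    and V: "\<And>n. n \<le> N \<Longrightarrow> DG_approx k M \<eta> (V n)"
    and Q: "\<And>n. n < N \<Longrightarrow> Q (V n) \<in> periodic_bdd"
      "\<And>n x. n < N \<Longrightarrow> \<bar>V (Suc n) x - Q (V n) x\<bar> \<le> \<delta>"
    and "0 \<le> \<delta>" "u0 \<in> periodic_bdd" "n \<le> N"
  shows "(F ^^ n) u0 \<in> periodic_bdd \<and> L2_dist (V n) ((F ^^ n) u0) \<le> L2_dist (V 0) u0 + real n * (\<delta> + c)"
  using \<open>n \<le> N\<close>
proof (induction n)
  case (Suc n)
  then have n: "n < N" and IH: "(F ^^ n) u0 \<in> periodic_bdd"
    "L2_dist (V n) ((F ^^ n) u0) \<le> L2_dist (V 0) u0 + real n * (\<delta> + c)"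
    by auto
  have step: "F ((F ^^ n) u0) \<in> periodic_bdd"
    "L2_dist (Q (V n)) (F ((F ^^ n) u0)) \<le> L2_dist (V n) ((F ^^ n) u0) + c"
    using F[OF V[OF less_imp_le[OF n]] IH(1)] by auto
  have V': "V (Suc n) \<in> periodic_bdd"
    using n by (intro DG_approx_periodic_bdd[OF V]) simp
  have "L2_dist (V (Suc n)) (Q (V n)) \<le> \<delta>"
    by (rule L2_norm01_le_bound[OF periodic_bdd_diff[OF V' Q(1)[OF n]] Q(2)[OF n] \<open>0 \<le> \<delta>\<close>])
  then have "L2_dist (V (Suc n)) (F ((F ^^ n) u0)) \<le> L2_dist (V 0) u0 + real (Suc n) * (\<delta> + c)"
    using L2_dist_triangle[OF V' Q(1)[OF n] step(1)] step(2) IH(2) by (simp add: algebra_simps)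
  with step(1) show ?case
    by simp
qed (simp add: \<open>u0 \<in> periodic_bdd\<close>)

text \<open>Padded with zeros to degree 3, so that \<open>op_comb 3\<close> serves all the
  schemes.\<close>

definition sldg_coeff :: "nat \<Rightarrow> nat \<Rightarrow> real" where
  "sldg_coeff p l =
     (if p = 1 then [0, 1, 0, 0] else if p = 2 then [1/3, 1/3, 1/3, 0] else [13/45, 7/15, 1/5, 2/45]) ! l"

lemma le_3_cases: "l \<le> 3 \<Longrightarrow> l = 0 \<or> l = 1 \<or> l = 2 \<or> l = (3::nat)"
  by auto

lemma sum_atMost_3: "(\<Sum>l\<le>3. f l) = f 0 + f 1 + f 2 + f (3::nat)" for f :: "nat \<Rightarrow> real"
  by (simp add: numeral_3_eq_3 numeral_2_eq_2)

lemma sldg_coeff_nonneg: "l \<le> 3 \<Longrightarrow> 0 \<le> sldg_coeff p l"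
  by (auto simp: sldg_coeff_def dest: le_3_cases)

lemma sldg_coeff_sum: "sum (sldg_coeff p) {..3} = 1"
  by (simp add: sum_atMost_3 sldg_coeff_def)

lemma funpow_3: "(A ^^ 3) u = A (A (A u))" and funpow_2: "(A ^^ 2) u = A (A u)"
  by (simp_all add: numeral_3_eq_3 numeral_2_eq_2)

lemma SLDG_eq_op_comb:
  assumes "p \<in> {1, 2, 3}"
  shows "SLDG p k M \<sigma> \<tau> = op_comb 3 (sldg_coeff p) (S_op k M \<sigma> \<tau>)"
  using assms
  by (auto simp: fun_eq_iff SLDG_def SLDG1_def SLDG2_def SLDG3_def op_comb_def sum_atMost_3
      sldg_coeff_def funpow_3 funpow_2)

lemma SLDG2_variant_eq_op_comb:
  "SLDG2_variant k M \<sigma> \<tau> u = DG_proj k M (op_comb 3 (sldg_coeff 2) (S0_op \<sigma> \<tau>) u)"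
  unfolding SLDG2_variant_def op_comb_def sum_atMost_3 sldg_coeff_def funpow_3 funpow_2
  by (simp add: add_divide_distrib)

lemma SLDG3_variant_eq_op_comb:
  "SLDG3_variant k M \<sigma> \<tau> u = DG_proj k M (op_comb 3 (sldg_coeff 3) (S0_op \<sigma> \<tau>) u)"
  unfolding SLDG3_variant_def op_comb_def sum_atMost_3 sldg_coeff_def funpow_3 funpow_2
  by simp

section \<open>Taylor expansions and the heat equation\<close>

lemma has_real_derivative_add_const:
  assumes "(f has_real_derivative d) (at (x + c))"
  shows "((\<lambda>x. f (x + c)) has_real_derivative d) (at x)"
  using DERIV_shift[of f d x c] assms by simp

lemma MVT_bound:
  fixes x y :: real
  assumes "\<And>x. (f has_real_derivative f' x) (at x)" "\<And>x. \<bar>f' x\<bar> \<le> B"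
  shows "\<bar>f y - f x\<bar> \<le> B * \<bar>y - x\<bar>"
  using field_differentiable_bound[of UNIV f f' B y x] assms by simp

lemma periodic_derivatives:
  fixes g :: "nat \<Rightarrow> real \<Rightarrow> real"
  assumes "\<And>j x. j < q \<Longrightarrow> (g j has_real_derivative g (Suc j) x) (at x)"
    and "\<And>x. g 0 (x + 1) = g 0 x" and "j \<le> q"
  shows "g j (x + 1) = g j x"
  using \<open>j \<le> q\<close>
proof (induction j arbitrary: x)
  case (Suc j)
  then have "(\<lambda>x. g j (x + 1)) = g j"
    by auto
  moreover have "((\<lambda>x. g j (x + 1)) has_real_derivative g (Suc j) (x + 1)) (at x)"
    using Suc.prems by (intro has_real_derivative_add_const assms(1)) auto
  ultimately show ?case
    using assms(1)[of j x] Suc.prems DERIV_unique by force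
qed (rule assms(2))

text \<open>
  By periodicity each derivative of positive order has a zero in every interval of length 1.
\<close>

lemma periodic_derivative_bound:
  fixes g :: "nat \<Rightarrow> real \<Rightarrow> real"
  assumes der: "\<And>j x. j < q \<Longrightarrow> (g j has_real_derivative g (Suc j) x) (at x)"
    and per: "\<And>x. g 0 (x + 1) = g 0 x" and bd: "\<And>x. \<bar>g q x\<bar> \<le> B"
    and j: "1 \<le> j" "j \<le> q"
  shows "\<bar>g j x\<bar> \<le> B"
  using j(2,1)
proof (induction j arbitrary: x rule: inc_induct)
  case (step j)
  have B: "0 \<le> B"
    using bd[of 0] by simp
  obtain i where i: "j = Suc i"
    using step.prems by (cases j) auto
  have "\<exists>z. x < z \<and> z < x + 1 \<and> g i (x + 1) - g i x = (x + 1 - x) * g j z"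
    using step.hyps i by (intro MVT2) (auto intro: der)
  then obtain z where z: "x < z" "z < x + 1" "g j z = 0"
    using periodic_derivatives[of q g i x, OF der per] step.hyps i by auto
  \<comment> \<open>The zero \<open>z\<close> lies within distance 1 of \<open>x\<close>, so the
    bound passes from order \<open>Suc j\<close> to order \<open>j\<close> with the same
    constant.\<close>
  have "\<exists>y. x < y \<and> y < z \<and> g j z - g j x = (z - x) * g (Suc j) y"
    using z(1) step.hyps by (intro MVT2) (auto intro: der)
  then obtain y where "g j z - g j x = (z - x) * g (Suc j) y"
    by blast
  then have "\<bar>g j x\<bar> = (z - x) * \<bar>g (Suc j) y\<bar>"
    using z by (simp add: abs_mult flip: abs_minus_cancel[of "g j x"])
  also have "\<dots> \<le> 1 * B"
    using z B step.IH[of y] by (intro mult_mono) auto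
  finally show ?case
    by simp
qed (rule bd)

lemma taylor_bound:
  fixes g :: "nat \<Rightarrow> real \<Rightarrow> real"
  assumes der: "\<And>j x. j < n \<Longrightarrow> (g j has_real_derivative g (Suc j) x) (at x)"
    and bd: "\<And>x. \<bar>g n x\<bar> \<le> B"
  shows "\<bar>g 0 (x + y) - (\<Sum>j<n. g j x / fact j * y ^ j)\<bar> \<le> \<bar>y\<bar> ^ n / fact n * B"
proof -
  have "\<exists>t. \<bar>t\<bar> \<le> \<bar>y\<bar> \<and> g 0 (y + x) = (\<Sum>m<n. g m (0 + x) / fact m * y ^ m) + g n (t + x) / fact n * y ^ n"
    using der by (intro Maclaurin_bi_le[where diff = "\<lambda>j t. g j (t + x)"])
      (auto intro: has_real_derivative_add_const)
  then obtain t where "g 0 (y + x) = (\<Sum>m<n. g m (0 + x) / fact m * y ^ m) + g n (t + x) / fact n * y ^ n"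
    by blast
  then have "g 0 (x + y) - (\<Sum>j<n. g j x / fact j * y ^ j) = y ^ n / fact n * g n (t + x)"
    by (simp add: add.commute[of x y])
  then show ?thesis
    using bd[of "t + x"] by (simp add: abs_mult power_abs mult_left_mono divide_right_mono)
qed

lemma even_part_sum:
  fixes c :: "nat \<Rightarrow> real"
  shows "(\<Sum>j<2 * m. c j * y ^ j) + (\<Sum>j<2 * m. c j * (- y) ^ j) = 2 * (\<Sum>j<m. c (2 * j) * y ^ (2 * j))"
  by (induction m) (auto simp: algebra_simps)

text \<open>Odd orders cancel in the symmetric average. Only powers of the second derivative remain,
  which is what the heat equation can match.\<close>

lemma central_taylor_bound:
  fixes g :: "nat \<Rightarrow> real \<Rightarrow> real"
  assumes der: "\<And>j x. j < 2 * m \<Longrightarrow> (g j has_real_derivative g (Suc j) x) (at x)"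
    and bd: "\<And>x. \<bar>g (2 * m) x\<bar> \<le> B"
  shows "\<bar>(g 0 (x + y) + g 0 (x - y)) / 2 - (\<Sum>j<m. y ^ (2 * j) / fact (2 * j) * g (2 * j) x)\<bar>
    \<le> y ^ (2 * m) / fact (2 * m) * B"
proof -
  define R where "R = (\<lambda>y. g 0 (x + y) - (\<Sum>j<2 * m. g j x / fact j * y ^ j))"
  have R: "\<bar>R z\<bar> \<le> z ^ (2 * m) / fact (2 * m) * B" for z
    using taylor_bound[of "2 * m" g B x z, OF der bd] by (simp add: R_def power_even_abs)
  have eq: "(g 0 (x + y) + g 0 (x - y)) / 2 - (\<Sum>j<m. y ^ (2 * j) / fact (2 * j) * g (2 * j) x)
      = (R y + R (- y)) / 2"
    using even_part_sum[of "\<lambda>j. g j x / fact j" y m] by (simp add: R_def field_simps)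
  have "\<bar>(p + q) / 2\<bar> \<le> c" if "\<bar>p\<bar> \<le> c" "\<bar>q\<bar> \<le> c" for p q c :: real
    using that by (simp add: abs_le_iff)
  moreover have "\<bar>R (- y)\<bar> \<le> y ^ (2 * m) / fact (2 * m) * B"
    using R[of "- y"] by simp
  ultimately show ?thesis
    unfolding eq using R[of y] by blast
qed

section \<open>Difference quotients and the expansion in time\<close>

definition diff_quot :: "real \<Rightarrow> (real \<Rightarrow> real) \<Rightarrow> real \<Rightarrow> real" where
  "diff_quot h f x = (f (x + h) - f x) / h"

lemma diff_quot_tendsto:
  assumes "(f has_real_derivative d) (at x)"
  shows "((\<lambda>h. diff_quot h f x) \<longlongrightarrow> d) (at 0)"
  using assms by (simp add: DERIV_def diff_quot_def)

lemma diff_quot_derivative: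
  assumes "\<And>x. (f has_real_derivative f' x) (at x)"
  shows "(diff_quot h f has_real_derivative diff_quot h f' x) (at x)"
  unfolding diff_quot_def[abs_def]
  by (intro DERIV_cdivide DERIV_diff has_real_derivative_add_const assms)

text \<open>Mean value theorem for \<open>h \<noteq> 0\<close>; at \<open>h = 0\<close> the quotient
  is 0 by the convention for division.\<close>

lemma diff_quot_bound:
  assumes "\<And>x. (f has_real_derivative f' x) (at x)" "\<And>x. \<bar>f' x\<bar> \<le> B"
  shows "\<bar>diff_quot h f x\<bar> \<le> B"
proof -
  have "0 \<le> B"
    using assms(2)[of 0] by simp
  then show ?thesis
    using MVT_bound[of f f' B "x + h" x, OF assms] by (auto simp: diff_quot_def divide_le_eq)
qed

text \<open>
  In the induction step the hypothesis is applied to second difference quotients of \<open>w\<close>, which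
  satisfy the heat equation again; letting the increments tend to 0 gives the expansion of \<open>w 2\<close>
  without any time regularity of the space derivatives.
\<close>

lemma heat_time_taylor:
  fixes w :: "nat \<Rightarrow> real \<Rightarrow> real \<Rightarrow> real"
  assumes a: "0 \<le> a"
    and "\<And>j t x. j < 2 * m \<Longrightarrow> 0 < t \<Longrightarrow> t < T \<Longrightarrow> (w j t has_real_derivative w (Suc j) t x) (at x)"
    and "\<And>t x. 0 < t \<Longrightarrow> t < T \<Longrightarrow> ((\<lambda>s. w 0 s x) has_real_derivative a * w 2 t x) (at t)"
    and "\<And>t x. 0 < t \<Longrightarrow> t < T \<Longrightarrow> \<bar>w (2 * m) t x\<bar> \<le> B"
    and t: "0 < t" "0 \<le> s" "t + s < T"
  shows "\<bar>w 0 (t + s) x - (\<Sum>j<m. (a * s) ^ j / fact j * w (2 * j) t x)\<bar> \<le> (a * s) ^ m / fact m * B"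
  using assms(2-4) t(2,3)
proof (induction m arbitrary: w s x)
  case 0
  then show ?case
    using t(1) by simp
next
  case (Suc m)
  note der = Suc.prems(1) and heat = Suc.prems(2) and bd = Suc.prems(3)
  \<comment> \<open>The quotients act in \<open>x\<close> and commute with the time derivative. The
    two of them use up two orders in \<open>x\<close>, the gap between \<open>2 * Suc m\<close> and
    \<open>2 * m\<close>, and preserve the bound \<open>B\<close>.\<close>
  have diff_quot_ineq: "\<bar>diff_quot h (diff_quot h' (w 0 (t + s))) x
      - (\<Sum>j<m. (a * s) ^ j / fact j * diff_quot h (diff_quot h' (w (2 * j) t)) x)\<bar> \<le> (a * s) ^ m / fact m * B"
    if s: "0 \<le> s" "t + s < T" for h h' s x
  proof (rule Suc.IH[of "\<lambda>j t. diff_quot h (diff_quot h' (w j t))"])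
    fix j u x
    assume u: "0 < u" "u < T"
    show "j < 2 * m \<Longrightarrow> (diff_quot h (diff_quot h' (w j u)) has_real_derivative
        diff_quot h (diff_quot h' (w (Suc j) u)) x) (at x)"
      using u by (intro diff_quot_derivative der) auto
    have "((\<lambda>s. diff_quot h (diff_quot h' (w 0 s)) x) has_real_derivative
        diff_quot h (diff_quot h' (\<lambda>x. a * w 2 u x)) x) (at u)"
      unfolding diff_quot_def using u by (intro DERIV_cdivide DERIV_diff heat)
    also have "diff_quot h (diff_quot h' (\<lambda>x. a * w 2 u x)) x = a * diff_quot h (diff_quot h' (w 2 u)) x"
      by (simp add: diff_quot_def algebra_simps diff_divide_distrib)
    finally show "((\<lambda>s. diff_quot h (diff_quot h' (w 0 s)) x) has_real_derivative
        a * diff_quot h (diff_quot h' (w 2 u)) x) (at u)" .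
    have "\<bar>diff_quot h' (w (Suc (2 * m)) u) x\<bar> \<le> B" for x
      using u der[of "Suc (2 * m)"] bd by (intro diff_quot_bound) auto
    then show "\<bar>diff_quot h (diff_quot h' (w (2 * m) u)) x\<bar> \<le> B"
      using u der[of "2 * m"] by (intro diff_quot_bound[OF diff_quot_derivative]) auto
  qed (use s in auto)
  have second: "\<bar>w 2 (t + s) x - (\<Sum>j<m. (a * s) ^ j / fact j * w (Suc (Suc (2 * j))) t x)\<bar> \<le> (a * s) ^ m / fact m * B"
    if s: "0 \<le> s" "t + s < T" for s x
  proof -
    have tT: "t < T" "0 < t + s"
      using s t(1) by auto
    have der0: "(w 0 (t + s) has_real_derivative w 1 (t + s) x) (at x)"
      "(w 1 (t + s) has_real_derivative w 2 (t + s) x) (at x)" for x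
      using der[of 0 "t + s"] der[of 1 "t + s"] tT s by (auto simp: numeral_2_eq_2)
    \<comment> \<open>The outer increment tends to 0 with \<open>h'\<close> fixed, and the remaining
      one follows. Each limit only involves derivatives in \<open>x\<close> at the fixed times
      \<open>t\<close> and \<open>t + s\<close>.\<close>
    have first: "\<bar>diff_quot h' (w 1 (t + s)) x
      - (\<Sum>j<m. (a * s) ^ j / fact j * diff_quot h' (w (Suc (2 * j)) t) x)\<bar> \<le> (a * s) ^ m / fact m * B" for h'
    proof (rule tendsto_upperbound[where F = "at 0"])
      show "((\<lambda>h. \<bar>diff_quot h (diff_quot h' (w 0 (t + s))) x
          - (\<Sum>j<m. (a * s) ^ j / fact j * diff_quot h (diff_quot h' (w (2 * j) t)) x)\<bar>)
          \<longlongrightarrow> \<bar>diff_quot h' (w 1 (t + s)) x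
          - (\<Sum>j<m. (a * s) ^ j / fact j * diff_quot h' (w (Suc (2 * j)) t) x)\<bar>) (at 0)"
        using t(1) tT by (intro tendsto_intros diff_quot_tendsto diff_quot_derivative der der0) auto
    qed (intro always_eventually allI diff_quot_ineq[OF s], simp)
    show ?thesis
    proof (rule tendsto_upperbound[where F = "at 0"])
      show "((\<lambda>h. \<bar>diff_quot h (w 1 (t + s)) x
          - (\<Sum>j<m. (a * s) ^ j / fact j * diff_quot h (w (Suc (2 * j)) t) x)\<bar>)
          \<longlongrightarrow> \<bar>w 2 (t + s) x - (\<Sum>j<m. (a * s) ^ j / fact j * w (Suc (Suc (2 * j))) t x)\<bar>) (at 0)"
        using t(1) tT by (intro tendsto_intros diff_quot_tendsto diff_quot_derivative der der0) auto
    qed (intro always_eventually allI first, simp)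
  qed
  define E where "E = (\<lambda>s. w 0 (t + s) x - (\<Sum>j<Suc m. (a * s) ^ j / fact j * w (2 * j) t x))"
  \<comment> \<open>The time derivative of \<open>E\<close>: the heat equation yields
    \<open>a * w 2\<close>, and each power of \<open>a * s\<close> drops by one degree, leaving
    \<open>a\<close> times the remainder estimated in \<open>second\<close>.\<close>
  define E' where "E' = (\<lambda>s. a * (w 2 (t + s) x - (\<Sum>j<m. (a * s) ^ j / fact j * w (Suc (Suc (2 * j))) t x)))"
  have pow: "((\<lambda>s. (a * s) ^ Suc j / fact (Suc j) * c) has_real_derivative a * ((a * s) ^ j / fact j * c)) (at s)"
    for j s c
  proof -
    have "((\<lambda>s. (a * s) ^ Suc j / fact (Suc j) * c) has_real_derivative
        real (Suc j) * (a * s) ^ j * a / fact (Suc j) * c) (at s)"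
      by (auto intro!: derivative_eq_intros simp del: power_Suc fact_Suc)
    also have "real (Suc j) * (a * s) ^ j * a / fact (Suc j) * c = a * ((a * s) ^ j / fact j * c)"
      by (simp add: field_simps del: of_nat_Suc)
    finally show ?thesis .
  qed
  have dE: "(E has_real_derivative E' s) (at s)" if "0 \<le> s" "t + s < T" for s
  proof -
    have "((\<lambda>s. w 0 (s + t) x) has_real_derivative a * w 2 (t + s) x) (at s)"
      using heat[of "t + s" x] that t(1) by (intro has_real_derivative_add_const) (simp add: add.commute)
    then have "((\<lambda>s. w 0 (t + s) x - (w 0 t x + (\<Sum>j<m. (a * s) ^ Suc j / fact (Suc j) * w (2 * Suc j) t x)))
        has_real_derivative a * w 2 (t + s) x - (0 + (\<Sum>j<m. a * ((a * s) ^ j / fact j * w (2 * Suc j) t x)))) (at s)"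
      by (intro DERIV_diff DERIV_add DERIV_const DERIV_sum pow) (simp add: add.commute)
    moreover have "E = (\<lambda>s. w 0 (t + s) x - (w 0 t x + (\<Sum>j<m. (a * s) ^ Suc j / fact (Suc j) * w (2 * Suc j) t x)))"
      unfolding E_def sum.lessThan_Suc_shift by simp
    moreover have "E' s = a * w 2 (t + s) x - (0 + (\<Sum>j<m. a * ((a * s) ^ j / fact j * w (2 * Suc j) t x)))"
      by (simp add: E'_def right_diff_distrib sum_distrib_left)
    ultimately show ?thesis
      by simp
  qed
  have E'_bound: "\<bar>E' s\<bar> \<le> a * ((a * s) ^ m / fact m * B)" if "0 \<le> s" "t + s < T" for s
    using mult_left_mono[OF second[OF that] a] a by (simp add: E'_def abs_mult)
  have E0: "E 0 = 0"
    unfolding E_def sum.lessThan_Suc_shift by simp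
  \<comment> \<open>The majorant plus \<open>e * E\<close> vanishes at time 0 and has nonnegative
    derivative; \<open>e = 1\<close> and \<open>e = -1\<close> give the two-sided bound.
    Monotonicity replaces integration of \<open>E'\<close>, which contains \<open>w 2\<close> at
    varying times.\<close>
  have "0 \<le> (a * s) ^ Suc m / fact (Suc m) * B + e * E s" if e: "\<bar>e\<bar> = 1" for e
  proof -
    have "(a * 0) ^ Suc m / fact (Suc m) * B + e * E 0 \<le> (a * s) ^ Suc m / fact (Suc m) * B + e * E s"
    proof (rule DERIV_nonneg_imp_nondecreasing[OF Suc.prems(4)])
      fix u assume u: "0 \<le> u" "u \<le> s"
      then have uT: "t + u < T"
        using Suc.prems(5) by simp
      have "\<bar>e * E' u\<bar> \<le> a * ((a * u) ^ m / fact m * B)"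
        using E'_bound[OF u(1) uT] e by (simp add: abs_mult)
      then show "\<exists>d. ((\<lambda>s. (a * s) ^ Suc m / fact (Suc m) * B + e * E s) has_real_derivative d) (at u) \<and> 0 \<le> d"
        using DERIV_add[OF pow DERIV_cmult[OF dE[OF u(1) uT]]]
        by (intro exI[of _ "a * ((a * u) ^ m / fact m * B) + e * E' u"] conjI) auto
    qed
    then show ?thesis
      using E0 by simp
  qed
  from this[of 1] this[of "-1"] show ?case
    unfolding E_def by (simp only: abs_le_iff) simp
qed

text \<open>On each cell \<open>w\<close> is the Taylor polynomial of degree \<open>k\<close> at the
  left end point. Distances to it are at most \<open>1 / M\<close>, and the factorial in the
  remainder is bounded below by 1.\<close>

lemma DG_space_approximation:
  fixes g :: "nat \<Rightarrow> real \<Rightarrow> real"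
  assumes M: "M \<ge> 1"
    and der: "\<And>j x. j < Suc k \<Longrightarrow> (g j has_real_derivative g (Suc j) x) (at x)"
    and bd: "\<And>x. \<bar>g (Suc k) x\<bar> \<le> B"
  shows "\<exists>w\<in>DG_space k M. \<forall>x\<in>{0<..<1}. \<bar>g 0 x - w x\<bar> \<le> B * (1 / real M) ^ (k + 1)"
proof -
  define P where "P = (\<lambda>i. \<Sum>j<Suc k. smult (g j (real i / real M) / fact j) ([:- (real i / real M), 1:] ^ j))"
  have "degree (P i) \<le> k" for i
    unfolding P_def by (intro degree_sum_le order_trans[OF degree_smult_le])
      (auto simp: degree_linear_power)
  then have "piecewise_poly M P \<in> DG_space k M"
    by (rule piecewise_poly_DG_space)
  moreover have "\<bar>g 0 x - piecewise_poly M P x\<bar> \<le> B * (1 / real M) ^ (k + 1)" if x: "x \<in> {0<..<1}" for x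
  proof -
    define i where "i = nat \<lfloor>real M * x\<rfloor>"
    define y where "y = x - real i / real M"
    have i: "real i / real M \<le> x" "x < real (i + 1) / real M"
      using nat_floor_unit_interval[OF M, of x] x by (auto simp: i_def)
    have y: "0 \<le> y" "y \<le> 1 / real M"
      using i by (auto simp: y_def add_divide_distrib)
    have "piecewise_poly M P x = poly (P i) x"
      using x by (simp add: piecewise_poly_def i_def frac_eq_id)
    also have "\<dots> = (\<Sum>j<Suc k. g j (real i / real M) / fact j * y ^ j)"
      by (simp add: P_def poly_sum y_def)
    finally have "\<bar>g 0 x - piecewise_poly M P x\<bar> \<le> \<bar>y\<bar> ^ Suc k / fact (Suc k) * B"
      using taylor_bound[of "Suc k" g B "real i / real M" y, OF der bd] by (simp add: y_def)
    also have "\<dots> \<le> (1 / real M) ^ Suc k / 1 * B"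
      using y bd[of 0] by (intro mult_right_mono frac_le power_mono fact_ge_1) auto
    finally show ?thesis
      by (simp add: mult.commute)
  qed
  ultimately show ?thesis
    by blast
qed

section \<open>Consistency and convergence\<close>

text \<open>
  The scheme is an average over a random walk with steps \<open>\<plusminus>\<sigma>\<surd>\<tau>\<close>; \<open>walk_coeff p l\<close> is the total weight
  of the displacements \<open>\<plusminus>l\<sigma>\<surd>\<tau>\<close>.
\<close>

definition walk_coeff :: "nat \<Rightarrow> nat \<Rightarrow> real" where
  "walk_coeff p l =
     (if p = 1 then [0, 1, 0, 0] else if p = 2 then [1/2, 1/3, 1/6, 0] else [7/18, 1/2, 1/10, 1/90]) ! l"

lemma walk_coeff_nonneg: "l \<le> 3 \<Longrightarrow> 0 \<le> walk_coeff p l"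
  by (auto simp: walk_coeff_def dest: le_3_cases)

lemma walk_coeff_sum: "sum (walk_coeff p) {..3} = 1"
  by (simp add: sum_atMost_3 walk_coeff_def)

text \<open>The moments of the walk agree with those of a Gaussian up to order \<open>2 p + 1\<close>.\<close>

lemma walk_coeff_moment:
  assumes "p \<in> {1, 2, 3}" "j \<le> p"
  shows "(\<Sum>l\<le>3. walk_coeff p l * (2 * (real l)\<^sup>2) ^ j / fact (2 * j)) = 1 / fact j"
proof -
  have "j = 0 \<or> j = 1 \<or> j = 2 \<or> j = 3"
    using assms by auto
  with assms show ?thesis
    by (auto simp: sum_atMost_3 walk_coeff_def fact_numeral)
qed

lemma S0_op_2:
  "S0_op \<sigma> \<tau> (S0_op \<sigma> \<tau> u) x = (u (x - 2 * (\<sigma> * sqrt \<tau>)) + 2 * u x + u (x + 2 * (\<sigma> * sqrt \<tau>))) / 4"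
proof -
  define s where "s = \<sigma> * sqrt \<tau>"
  have eqs: "x - s - s = x - 2 * s" "x - s + s = x" "x + s - s = x" "x + s + s = x + 2 * s"
    by auto
  show ?thesis
    unfolding S0_op_def s_def[symmetric] eqs by (simp add: add_divide_distrib)
qed

lemma S0_op_3:
  "S0_op \<sigma> \<tau> (S0_op \<sigma> \<tau> (S0_op \<sigma> \<tau> u)) x =
    (u (x - 3 * (\<sigma> * sqrt \<tau>)) + 3 * u (x - \<sigma> * sqrt \<tau>)
      + 3 * u (x + \<sigma> * sqrt \<tau>) + u (x + 3 * (\<sigma> * sqrt \<tau>))) / 8"
proof -
  define s where "s = \<sigma> * sqrt \<tau>"
  have eqs: "x - 2 * s - s = x - 3 * s" "x - 2 * s + s = x - s" "x + 2 * s - s = x + s" "x + 2 * s + s = x + 3 * s"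
    by auto
  show ?thesis
    unfolding S0_op_2[of _ _ "S0_op \<sigma> \<tau> u"] unfolding S0_op_def s_def[symmetric] eqs by (simp add: add_divide_distrib)
qed

text \<open>The walk makes \<open>l\<close> steps with probability \<open>sldg_coeff p l\<close>.
  Two steps end at 0 or at distance 2 with probability 1/2 each, three steps at distance 1 or 3 with
  probabilities 3/4 and 1/4; collecting the distances gives \<open>walk_coeff\<close>.\<close>

lemma op_comb_S0_eq_walk:
  assumes "p \<in> {1, 2, 3}"
  shows "op_comb 3 (sldg_coeff p) (S0_op \<sigma> \<tau>) u x =
    (\<Sum>l\<le>3. walk_coeff p l * ((u (x + real l * (\<sigma> * sqrt \<tau>)) + u (x - real l * (\<sigma> * sqrt \<tau>))) / 2))"
proof -
  have S1: "S0_op \<sigma> \<tau> u x = (u (x - \<sigma> * sqrt \<tau>) + u (x + \<sigma> * sqrt \<tau>)) / 2"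
    by (simp add: S0_op_def)
  consider "p = 1" | "p = 2" | "p = 3"
    using assms by auto
  then show ?thesis
    unfolding op_comb_def sum_atMost_3 funpow_3 funpow_2 S0_op_3
    unfolding S0_op_2
    by cases (simp_all add: sldg_coeff_def walk_coeff_def S1 add_divide_distrib algebra_simps)
qed

text \<open>The central expansions of the displacements are averaged with the walk weights. The
  constant 9 is the square of the largest displacement, three steps.\<close>

lemma op_comb_S0_taylor:
  fixes g :: "nat \<Rightarrow> real \<Rightarrow> real"
  assumes p: "p \<in> {1, 2, 3}" and \<tau>: "0 \<le> \<tau>"
    and der: "\<And>j x. j < 2 * Suc p \<Longrightarrow> (g j has_real_derivative g (Suc j) x) (at x)"
    and bd: "\<And>x. \<bar>g (2 * Suc p) x\<bar> \<le> B"
  shows "\<bar>op_comb 3 (sldg_coeff p) (S0_op \<sigma> \<tau>) (g 0) x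
      - (\<Sum>j<Suc p. (\<sigma>\<^sup>2 / 2 * \<tau>) ^ j / fact j * g (2 * j) x)\<bar> \<le> (9 * \<sigma>\<^sup>2 * \<tau>) ^ Suc p * B"
proof -
  define r where "r = \<sigma>\<^sup>2 / 2 * \<tau>"
  define s where "s = \<sigma> * sqrt \<tau>"
  define A where "A = (\<lambda>l. (g 0 (x + real l * s) + g 0 (x - real l * s)) / 2)"
  define P where "P = (\<lambda>l. \<Sum>j<Suc p. (real l * s) ^ (2 * j) / fact (2 * j) * g (2 * j) x)"
  have s2: "(real l * s)\<^sup>2 = 2 * (real l)\<^sup>2 * r" for l
    using \<tau> by (simp add: s_def r_def power_mult_distrib)
  have B: "0 \<le> B"
    using bd[of 0] by simp
  have "(\<Sum>l\<le>3. walk_coeff p l * P l)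
      = (\<Sum>l\<le>3. \<Sum>j<Suc p. (walk_coeff p l * (2 * (real l)\<^sup>2) ^ j / fact (2 * j)) * (r ^ j * g (2 * j) x))"
    unfolding P_def sum_distrib_left power_mult s2 power_mult_distrib[of _ r]
    by (intro sum.cong refl) simp
  \<comment> \<open>After the interchange the inner sum is a moment of the walk, and it turns into
    the exponential coefficient \<open>1 / fact j\<close>.\<close>
  also have "\<dots> = (\<Sum>j<Suc p. (\<Sum>l\<le>3. walk_coeff p l * (2 * (real l)\<^sup>2) ^ j / fact (2 * j)) * (r ^ j * g (2 * j) x))"
    by (subst sum.swap) (simp only: sum_distrib_right)
  also have "\<dots> = (\<Sum>j<Suc p. r ^ j / fact j * g (2 * j) x)"
    using walk_coeff_moment[OF p] by (intro sum.cong refl) simp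
  finally have P: "(\<Sum>l\<le>3. walk_coeff p l * P l) = (\<Sum>j<Suc p. r ^ j / fact j * g (2 * j) x)" .
  have AP: "\<bar>A l - P l\<bar> \<le> (9 * \<sigma>\<^sup>2 * \<tau>) ^ Suc p * B" if l: "l \<le> 3" for l
  proof -
    have "\<bar>A l - P l\<bar> \<le> (real l * s) ^ (2 * Suc p) / fact (2 * Suc p) * B"
      unfolding A_def P_def using der bd by (rule central_taylor_bound)
    also have "\<dots> \<le> (9 * \<sigma>\<^sup>2 * \<tau>) ^ Suc p / 1 * B"
    proof (intro mult_right_mono frac_le fact_ge_1 B)
      have "(real l)\<^sup>2 \<le> 3\<^sup>2"
        using l by (intro power_mono) auto
      then have "(real l * s)\<^sup>2 \<le> 9 * (\<sigma>\<^sup>2 * \<tau>)"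
        using \<tau> mult_right_mono[of "(real l)\<^sup>2" 9 "\<sigma>\<^sup>2 * \<tau>"] by (simp add: s2 r_def)
      then show "(real l * s) ^ (2 * Suc p) \<le> (9 * \<sigma>\<^sup>2 * \<tau>) ^ Suc p"
        unfolding power_mult by (intro power_mono) (auto simp: mult.assoc)
    qed (use \<tau> in auto)
    finally show ?thesis
      by simp
  qed
  have "\<bar>(\<Sum>l\<le>3. walk_coeff p l * A l) - (\<Sum>l\<le>3. walk_coeff p l * P l)\<bar>
      \<le> (\<Sum>l\<le>3. walk_coeff p l * ((9 * \<sigma>\<^sup>2 * \<tau>) ^ Suc p * B))"
    unfolding sum_subtractf[symmetric] right_diff_distrib[symmetric]
    using AP walk_coeff_nonneg[of _ p]
    by (intro order_trans[OF sum_abs] sum_mono) (auto simp: abs_mult intro!: mult_left_mono)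
  also have "\<dots> = (9 * \<sigma>\<^sup>2 * \<tau>) ^ Suc p * B"
    by (simp add: walk_coeff_sum flip: sum_distrib_right)
  finally show ?thesis
    unfolding P op_comb_S0_eq_walk[OF p] by (simp only: A_def r_def s_def)
qed

section \<open>The exact solution up to the end times: continuity, approximability and
  consistency\<close>

lemma periodic_continuous_periodic_bdd:
  assumes "continuous_on UNIV f" "\<And>x. f (x + 1) = f x"
  shows "f \<in> periodic_bdd"
proof -
  have "bounded (f ` {0..1})"
    using assms(1) by (intro compact_imp_bounded compact_continuous_image) (auto intro: continuous_on_subset)
  then obtain B where B: "\<forall>x\<in>{0..1}. \<bar>f x\<bar> \<le> B"
    by (auto simp: bounded_iff)
  have "\<bar>f x\<bar> \<le> B" for x
    using bspec[OF B, of "frac x"] periodic_frac[of f x, OF assms(2)] frac_lt_1[of x] by (simp add: less_imp_le)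
  then show ?thesis
    using assms by (intro periodic_bddI) (auto intro: borel_measurable_continuous_onI)
qed

lemma heat_solution_continuous:
  assumes "periodic_heat_solution \<sigma> T v0 v" "t \<in> {0..T}"
  shows "continuous_on UNIV (v t)"
proof -
  have "continuous_on UNIV ((\<lambda>(t, x). v t x) \<circ> (\<lambda>x. (t, x)))"
    using assms
    by (intro continuous_on_compose continuous_intros)
      (auto simp: periodic_heat_solution_def elim: continuous_on_subset)
  then show ?thesis
    by (simp add: o_def)
qed

lemma heat_solution_periodic:
  assumes "periodic_heat_solution \<sigma> T v0 v" "t \<in> {0..T}"
  shows "v t (x + 1) = v t x"
  using assms by (simp add: periodic_heat_solution_def)

text \<open>Derivative bounds are available only for \<open>0 < t < T\<close>. Uniform continuity
  over one closed period carries estimates to the end times, uniformly in \<open>x\<close>.\<close>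

lemma heat_solution_near_interior:
  assumes v: "periodic_heat_solution \<sigma> T v0 v" and "0 < T" and t: "t \<in> {0..T}" and "0 < \<epsilon>"
  obtains t' where "t' \<in> {0<..<T}" "\<And>x. \<bar>v t x - v t' x\<bar> \<le> \<epsilon>"
proof -
  have "uniformly_continuous_on ({0..T} \<times> {0..1}) (\<lambda>(t, x). v t x)"
    using v by (intro compact_uniformly_continuous compact_Times)
      (auto simp: periodic_heat_solution_def elim: continuous_on_subset)
  then obtain d where d: "d > 0" "\<And>z z'. z \<in> {0..T} \<times> {0..1} \<Longrightarrow> z' \<in> {0..T} \<times> {0..1} \<Longrightarrow> dist z' z < d \<Longrightarrow>
      dist (case z' of (t, x) \<Rightarrow> v t x) (case z of (t, x) \<Rightarrow> v t x) < \<epsilon>"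
    using \<open>0 < \<epsilon>\<close> unfolding uniformly_continuous_on_def by blast
  \<comment> \<open>Moving towards the middle by at most \<open>T / 4\<close> ends strictly inside
    the interval from either half.\<close>
  obtain t' where t': "t' \<in> {0<..<T}" "\<bar>t - t'\<bar> < d"
  proof (cases "t < T / 2")
    case True
    then show thesis
      using t \<open>0 < T\<close> d(1) by (intro that[of "t + min (d / 2) (T / 4)"]) auto
  next
    case False
    then show thesis
      using t \<open>0 < T\<close> d(1) by (intro that[of "t - min (d / 2) (T / 4)"]) auto
  qed
  have "\<bar>v t x - v t' x\<bar> \<le> \<epsilon>" for x
  proof -
    have "dist (t, frac x) (t', frac x) < d"
      using t'(2) by (simp add: dist_Pair_Pair dist_real_def)
    then have "\<bar>v t (frac x) - v t' (frac x)\<bar> < \<epsilon>"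
      using d(2)[of "(t', frac x)" "(t, frac x)"] t t'(1) frac_lt_1[of x] by (simp add: dist_real_def less_imp_le)
    then show ?thesis
      using periodic_frac[of "v t" x] periodic_frac[of "v t'" x] heat_solution_periodic[OF v] t t'(1) by simp
  qed
  with t'(1) show thesis
    by (rule that)
qed

lemma tendsto_heat_solution:
  assumes v: "periodic_heat_solution \<sigma> T v0 v" and t: "t \<in> {0..T}"
    and "(f \<longlongrightarrow> t) F" "(g \<longlongrightarrow> x) F" "\<forall>\<^sub>F \<delta> in F. f \<delta> \<in> {0..T}"
  shows "((\<lambda>\<delta>. v (f \<delta>) (g \<delta>)) \<longlongrightarrow> v t x) F"
proof -
  have cont: "continuous_on ({0..T} \<times> UNIV) (\<lambda>(t, x). v t x)"
    using v by (simp add: periodic_heat_solution_def)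
  have "((\<lambda>\<delta>. case (f \<delta>, g \<delta>) of (t, x) \<Rightarrow> v t x) \<longlongrightarrow> (case (t, x) of (t, x) \<Rightarrow> v t x)) F"
    by (rule continuous_on_tendsto_compose[OF cont tendsto_Pair[OF assms(3,4)]]) (use t assms(5) in auto)
  then show ?thesis
    by simp
qed

lemma bounded_x_derivativeE:
  assumes v: "periodic_heat_solution \<sigma> T v0 v" and "bounded_x_derivative q T v" and "0 < T"
  obtains B where "0 \<le> B"
    "\<And>j t x. j < q \<Longrightarrow> t \<in> {0<..<T} \<Longrightarrow> ((deriv ^^ j) (v t) has_real_derivative (deriv ^^ Suc j) (v t) x) (at x)"
    "\<And>j t x. 1 \<le> j \<Longrightarrow> j \<le> q \<Longrightarrow> t \<in> {0<..<T} \<Longrightarrow> \<bar>(deriv ^^ j) (v t) x\<bar> \<le> B"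
proof -
  have der: "((deriv ^^ j) (v t) has_real_derivative (deriv ^^ Suc j) (v t) x) (at x)"
    if "j < q" "t \<in> {0<..<T}" for j t x
    using assms(2) that by (simp add: bounded_x_derivative_def DERIV_deriv_iff_real_differentiable)
  obtain B where B: "\<And>t x. t \<in> {0<..<T} \<Longrightarrow> \<bar>(deriv ^^ q) (v t) x\<bar> \<le> B"
    using assms(2) unfolding bounded_x_derivative_def by blast
  have "0 \<le> B"
    using B[of "T / 2" 0] \<open>0 < T\<close> by simp
  moreover have "\<bar>(deriv ^^ j) (v t) x\<bar> \<le> B" if "1 \<le> j" "j \<le> q" "t \<in> {0<..<T}" for j t x
    using periodic_derivative_bound[of q "\<lambda>j. (deriv ^^ j) (v t)" B j x] der B that
      heat_solution_periodic[OF v, of t] by simp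
  ultimately show thesis
    using that der by blast
qed

lemma heat_solution_DG_approx:
  assumes v: "periodic_heat_solution \<sigma> T v0 v" and "bounded_x_derivative q T v" and T: "0 < T" and "k + 1 \<le> q"
  obtains B where "0 \<le> B" "\<And>M t. M \<ge> 1 \<Longrightarrow> t \<in> {0..T} \<Longrightarrow> DG_approx k M (B * (1 / real M) ^ (k + 1)) (v t)"
proof -
  obtain B where B: "0 \<le> B"
    and der: "\<And>j t x. j < q \<Longrightarrow> t \<in> {0<..<T} \<Longrightarrow> ((deriv ^^ j) (v t) has_real_derivative (deriv ^^ Suc j) (v t) x) (at x)"
    and bd: "\<And>j t x. 1 \<le> j \<Longrightarrow> j \<le> q \<Longrightarrow> t \<in> {0<..<T} \<Longrightarrow> \<bar>(deriv ^^ j) (v t) x\<bar> \<le> B"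
    using bounded_x_derivativeE[OF v assms(2) T] by metis
  \<comment> \<open>The extra 1 in \<open>B + 1\<close> pays for replacing \<open>t\<close> by an
    interior time, at a cost of one power \<open>(1 / M) ^ (k + 1)\<close>.\<close>
  have "DG_approx k M ((B + 1) * (1 / real M) ^ (k + 1)) (v t)" if M: "M \<ge> 1" and t: "t \<in> {0..T}" for M t
    unfolding DG_approx_def
  proof (intro conjI allI)
    show pb: "v t \<in> periodic_bdd"
      using heat_solution_continuous[OF v t] heat_solution_periodic[OF v t] by (rule periodic_continuous_periodic_bdd)
    fix b
    define h where "h = (1 / real M) ^ (k + 1)"
    have h: "0 < h"
      using M by (simp add: h_def)
    obtain t' where t': "t' \<in> {0<..<T}" "\<And>x. \<bar>v t x - v t' x\<bar> \<le> h"
      by (rule heat_solution_near_interior[OF v T t h]) blast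
    have "\<exists>w\<in>DG_space k M. \<forall>x\<in>{0<..<1}. \<bar>(deriv ^^ 0) (v t') (x + b) - w x\<bar> \<le> B * (1 / real M) ^ (k + 1)"
      using M
    proof (rule DG_space_approximation[where g = "\<lambda>j x. (deriv ^^ j) (v t') (x + b)"])
      show "((\<lambda>x. (deriv ^^ j) (v t') (x + b)) has_real_derivative (deriv ^^ Suc j) (v t') (x + b)) (at x)"
        if "j < Suc k" for j x
        using that assms(4) t'(1) by (intro has_real_derivative_add_const der) auto
      show "\<bar>(deriv ^^ Suc k) (v t') (x + b)\<bar> \<le> B" for x
        using assms(4) t'(1) by (intro bd) auto
    qed
    then obtain w where w: "w \<in> DG_space k M" "\<And>x. x \<in> {0<..<1} \<Longrightarrow> \<bar>v t' (x + b) - w x\<bar> \<le> B * h"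
      unfolding h_def by auto
    have "L2_dist (\<lambda>x. v t (x + b)) w \<le> (B + 1) * h"
    proof (rule L2_norm01_le_bound)
      show "(\<lambda>x. v t (x + b) - w x) \<in> periodic_bdd"
        by (intro periodic_bdd_diff periodic_bdd_shift[OF pb] DG_space_periodic_bdd[OF M w(1)])
      show "\<bar>v t (x + b) - w x\<bar> \<le> (B + 1) * h" if "x \<in> {0<..<1}" for x
        using w(2)[OF that] t'(2)[of "x + b"] by (simp add: algebra_simps abs_le_iff)
    qed (use B h in simp)
    with w(1) show "\<exists>w\<in>DG_space k M. L2_dist (\<lambda>x. v t (x + b)) w \<le> (B + 1) * (1 / real M) ^ (k + 1)"
      unfolding h_def by blast
  qed
  then show thesis
    using that[of "B + 1"] B by simp
qed

text \<open>The exact solution and the walk average share the polynomial \<open>P\<close> as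
  expansion at interior times; the two remainders are the two summands of \<open>C\<close>.\<close>

lemma heat_solution_consistency:
  assumes p: "p \<in> {1, 2, 3}" and v: "periodic_heat_solution \<sigma> T v0 v" and "bounded_x_derivative q T v"
    and T: "0 < T" and "2 * p + 2 \<le> q"
  obtains C where "0 \<le> C"
    "\<And>t s x. 0 \<le> t \<Longrightarrow> 0 < s \<Longrightarrow> t + s \<le> T \<Longrightarrow>
      \<bar>v (t + s) x - op_comb 3 (sldg_coeff p) (S0_op \<sigma> s) (v t) x\<bar> \<le> C * s ^ Suc p"
proof -
  obtain B where B: "0 \<le> B"
    and der: "\<And>j t x. j < q \<Longrightarrow> t \<in> {0<..<T} \<Longrightarrow> ((deriv ^^ j) (v t) has_real_derivative (deriv ^^ Suc j) (v t) x) (at x)"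
    and bd: "\<And>j t x. 1 \<le> j \<Longrightarrow> j \<le> q \<Longrightarrow> t \<in> {0<..<T} \<Longrightarrow> \<bar>(deriv ^^ j) (v t) x\<bar> \<le> B"
    using bounded_x_derivativeE[OF v assms(3) T] by metis
  define Q where "Q = (\<lambda>s. op_comb 3 (sldg_coeff p) (S0_op \<sigma> s))"
  define C where "C = ((\<sigma>\<^sup>2 / 2) ^ Suc p + (9 * \<sigma>\<^sup>2) ^ Suc p) * B"
  have C: "0 \<le> C"
    using B by (simp add: C_def)
  have interior: "\<bar>v (t + s) x - Q s (v t) x\<bar> \<le> C * s ^ Suc p" if t: "0 < t" "0 \<le> s" "t + s < T" for t s x
  proof -
    define P where "P = (\<Sum>j<Suc p. (\<sigma>\<^sup>2 / 2 * s) ^ j / fact j * (deriv ^^ (2 * j)) (v t) x)"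
    have "\<bar>(deriv ^^ 0) (v (t + s)) x - P\<bar> \<le> (\<sigma>\<^sup>2 / 2 * s) ^ Suc p / fact (Suc p) * B"
      unfolding P_def
    proof (rule heat_time_taylor[where w = "\<lambda>j t. (deriv ^^ j) (v t)" and T = T])
      fix u x assume u: "0 < u" "u < T"
      show "((\<lambda>s. (deriv ^^ 0) (v s) x) has_real_derivative \<sigma>\<^sup>2 / 2 * (deriv ^^ 2) (v u) x) (at u)"
        using v u by (simp add: periodic_heat_solution_def numeral_2_eq_2)
      show "((deriv ^^ j) (v u) has_real_derivative (deriv ^^ Suc j) (v u) x) (at x)" if "j < 2 * Suc p" for j
        using u that assms(5) by (intro der) auto
      show "\<bar>(deriv ^^ (2 * Suc p)) (v u) x\<bar> \<le> B"
        using u assms(5) by (intro bd) auto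
    qed (use t in auto)
    also have "\<dots> \<le> (\<sigma>\<^sup>2 / 2 * s) ^ Suc p / 1 * B"
      using t B by (intro mult_right_mono frac_le fact_ge_1) auto
    finally have 1: "\<bar>v (t + s) x - P\<bar> \<le> (\<sigma>\<^sup>2 / 2) ^ Suc p * B * s ^ Suc p"
      by (simp only: power_mult_distrib) (simp add: mult_ac)
    have "\<bar>Q s ((deriv ^^ 0) (v t)) x - P\<bar> \<le> (9 * \<sigma>\<^sup>2 * s) ^ Suc p * B"
      unfolding P_def Q_def
    proof (rule op_comb_S0_taylor[OF p, where g = "\<lambda>j. (deriv ^^ j) (v t)"])
      show "((deriv ^^ j) (v t) has_real_derivative (deriv ^^ Suc j) (v t) x) (at x)" if "j < 2 * Suc p" for j x
        using t that assms(5) by (intro der) auto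
      show "\<bar>(deriv ^^ (2 * Suc p)) (v t) x\<bar> \<le> B" for x
        using t assms(5) by (intro bd) auto
    qed (use t in auto)
    then have 2: "\<bar>Q s (v t) x - P\<bar> \<le> (9 * \<sigma>\<^sup>2) ^ Suc p * B * s ^ Suc p"
      by (simp only: power_mult_distrib) (simp add: mult_ac)
    have "C * s ^ Suc p = (\<sigma>\<^sup>2 / 2) ^ Suc p * B * s ^ Suc p + (9 * \<sigma>\<^sup>2) ^ Suc p * B * s ^ Suc p"
      unfolding C_def by (simp only: distrib_right mult.assoc)
    with 1 2 show ?thesis
      by linarith
  qed
  \<comment> \<open>To reach times 0 and \<open>T\<close>, the step is shrunk to
    \<open>[t + \<delta>, t + s - \<delta>]\<close>, of length \<open>s - 2 * \<delta>\<close>. As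
    \<open>Q\<close> is a finite sum of values of \<open>v\<close>, joint continuity gives the limit
    even though the displacements vary with \<open>\<delta>\<close>.\<close>
  have "\<bar>v (t + s) x - Q s (v t) x\<bar> \<le> C * s ^ Suc p" if t: "0 \<le> t" "0 < s" "t + s \<le> T" for t s x
  proof (rule tendsto_upperbound[where F = "at_right 0"])
    have ev: "\<forall>\<^sub>F \<delta> in at_right 0. 0 < \<delta> \<and> \<delta> < s / 2"
      using eventually_at_right_real[of 0 "s / 2"] t by (simp add: eventually_at_filter) 
    have lim: "((\<lambda>\<delta>. t + \<delta>) \<longlongrightarrow> t + 0) (at_right 0)" "((\<lambda>\<delta>. t + s - \<delta>) \<longlongrightarrow> t + s - 0) (at_right 0)"
      "((\<lambda>\<delta>. s - 2 * \<delta>) \<longlongrightarrow> s - 2 * 0) (at_right 0)"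
      by (intro tendsto_intros)+
    have "((\<lambda>\<delta>. v (t + \<delta>) (x + c * (\<sigma> * sqrt (s - 2 * \<delta>)))) \<longlongrightarrow> v t (x + c * (\<sigma> * sqrt s))) (at_right 0)" for c
    proof (rule tendsto_heat_solution[OF v])
      show "((\<lambda>\<delta>. x + c * (\<sigma> * sqrt (s - 2 * \<delta>))) \<longlongrightarrow> x + c * (\<sigma> * sqrt s)) (at_right 0)"
        using lim(3) by (intro tendsto_intros) simp
      show "\<forall>\<^sub>F \<delta> in at_right 0. t + \<delta> \<in> {0..T}"
        using ev by eventually_elim (use t in auto)
    qed (use t lim(1) in auto)
    from this[of "real _"] this[of "- real _"] have walk:
      "((\<lambda>\<delta>. Q (s - 2 * \<delta>) (v (t + \<delta>)) x) \<longlongrightarrow> Q s (v t) x) (at_right 0)"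
      unfolding Q_def op_comb_S0_eq_walk[OF p] by (intro tendsto_intros) simp_all
    have "((\<lambda>\<delta>. v (t + s - \<delta>) x) \<longlongrightarrow> v (t + s) x) (at_right 0)"
    proof (rule tendsto_heat_solution[OF v])
      show "\<forall>\<^sub>F \<delta> in at_right 0. t + s - \<delta> \<in> {0..T}"
        using ev by eventually_elim (use t in auto)
    qed (use t lim(2) in auto)
    with walk show "((\<lambda>\<delta>. \<bar>v (t + s - \<delta>) x - Q (s - 2 * \<delta>) (v (t + \<delta>)) x\<bar>)
        \<longlongrightarrow> \<bar>v (t + s) x - Q s (v t) x\<bar>) (at_right 0)"
      by (intro tendsto_intros)
    show "\<forall>\<^sub>F \<delta> in at_right 0. \<bar>v (t + s - \<delta>) x - Q (s - 2 * \<delta>) (v (t + \<delta>)) x\<bar> \<le> C * s ^ Suc p"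
      using ev
    proof eventually_elim
      fix \<delta> assume \<delta>: "0 < \<delta> \<and> \<delta> < s / 2"
      have eq: "t + \<delta> + (s - 2 * \<delta>) = t + s - \<delta>"
        by simp
      have "\<bar>v (t + s - \<delta>) x - Q (s - 2 * \<delta>) (v (t + \<delta>)) x\<bar> \<le> C * (s - 2 * \<delta>) ^ Suc p"
        using interior[of "t + \<delta>" "s - 2 * \<delta>" x, unfolded eq] \<delta> t by auto
      also have "\<dots> \<le> C * s ^ Suc p"
        using C \<delta> by (intro mult_left_mono power_mono) auto
      finally show "\<bar>v (t + s - \<delta>) x - Q (s - 2 * \<delta>) (v (t + \<delta>)) x\<bar> \<le> C * s ^ Suc p" .
    qed
  qed simp
  with C show thesis
    using that[of C] by (simp add: Q_def)
qed

text \<open>\<open>F\<close> is abstract so that schemes and variants share the argument; the factor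
  3 is the largest number of projections nested in one step.\<close>

lemma scheme_convergence:
  fixes F :: "nat \<Rightarrow> real \<Rightarrow> (real \<Rightarrow> real) \<Rightarrow> real \<Rightarrow> real"
  assumes p: "p \<in> {1, 2, 3}" and T: "0 < T" and v: "periodic_heat_solution \<sigma> T v0 v"
    and reg: "bounded_x_derivative (max (k + 2) (2 * p + 2)) T v"
    and F: "\<And>M \<tau> \<eta> f u. M \<ge> 1 \<Longrightarrow> 0 \<le> \<eta> \<Longrightarrow> DG_approx k M \<eta> f \<Longrightarrow> u \<in> periodic_bdd \<Longrightarrow>
      F M \<tau> u \<in> periodic_bdd \<and>
      L2_dist (op_comb 3 (sldg_coeff p) (S0_op \<sigma> \<tau>) f) (F M \<tau> u) \<le> L2_dist f u + 3 * \<eta>"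
  shows "\<exists>C\<ge>0. \<forall>N\<ge>1. \<forall>M\<ge>1. \<forall>n\<le>N.
            let \<tau> = T / real N; h = 1 / real M;
                u = (\<lambda>m. (F M \<tau> ^^ m) (DG_proj k M v0))
            in L2_norm01 (\<lambda>x. v (real n * \<tau>) x - u n x)
                 \<le> L2_norm01 (\<lambda>x. v 0 x - u 0 x) + C * T * (h ^ (k + 1) / \<tau> + \<tau> ^ p)"
proof -
  obtain B where B: "0 \<le> B"
    and approx: "\<And>M t. M \<ge> 1 \<Longrightarrow> t \<in> {0..T} \<Longrightarrow> DG_approx k M (B * (1 / real M) ^ (k + 1)) (v t)"
    by (rule heat_solution_DG_approx[OF v reg T, where k = k]) auto
  obtain A where A: "0 \<le> A"
    and cons: "\<And>t s x. 0 \<le> t \<Longrightarrow> 0 < s \<Longrightarrow> t + s \<le> T \<Longrightarrow>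
      \<bar>v (t + s) x - op_comb 3 (sldg_coeff p) (S0_op \<sigma> s) (v t) x\<bar> \<le> A * s ^ Suc p"
    by (rule heat_solution_consistency[OF p v reg T]) auto
  have v0: "v0 = v 0"
    using v by (auto simp: periodic_heat_solution_def)
  have main: "L2_dist (v (real n * (T / real N))) ((F M (T / real N) ^^ n) (DG_proj k M v0))
      \<le> L2_dist (v 0) (DG_proj k M v0)
        + (A + 3 * B) * T * ((1 / real M) ^ (k + 1) / (T / real N) + (T / real N) ^ p)"
    if N: "N \<ge> 1" and M: "M \<ge> 1" and n: "n \<le> N" for N M n
  proof -
    define \<tau> where "\<tau> = T / real N"
    define h where "h = (1 / real M) ^ (k + 1)"
    define V where "V = (\<lambda>n. v (real n * \<tau>))"
    have \<tau>: "0 < \<tau>" and N\<tau>: "real N * \<tau> = T"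
      using T N by (auto simp: \<tau>_def)
    have h: "0 \<le> h"
      by (simp add: h_def)
    have time: "real n * \<tau> \<in> {0..T}" if "n \<le> N" for n
      using that \<tau> mult_right_mono[of "real n" "real N" \<tau>] by (auto simp: N\<tau>)
    have V: "DG_approx k M (B * h) (V n)" if "n \<le> N" for n
      unfolding V_def h_def using M time[OF that] by (rule approx)
    have "L2_dist (V n) ((F M \<tau> ^^ n) (DG_proj k M v0))
        \<le> L2_dist (V 0) (DG_proj k M v0) + real n * (A * \<tau> ^ Suc p + 3 * (B * h))"
    proof (rule scheme_error[where Q = "op_comb 3 (sldg_coeff p) (S0_op \<sigma> \<tau>)", THEN conjunct2])
      show "DG_proj k M v0 \<in> periodic_bdd"
        unfolding v0 using DG_approx_periodic_bdd[OF V[of 0]] by (intro DG_proj_periodic_bdd[OF M]) (simp add: V_def)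
      show "op_comb 3 (sldg_coeff p) (S0_op \<sigma> \<tau>) (V n) \<in> periodic_bdd" if "n < N" for n
        unfolding op_comb_def using DG_approx_periodic_bdd[OF V[of n]] that
        by (intro periodic_bdd_sum periodic_bdd_cmult S0_op_funpow_periodic_bdd) auto
      show "\<bar>V (Suc n) x - op_comb 3 (sldg_coeff p) (S0_op \<sigma> \<tau>) (V n) x\<bar> \<le> A * \<tau> ^ Suc p" if "n < N" for n x
        using cons[of "real n * \<tau>" \<tau> x] time[of "Suc n"] that \<tau> by (simp add: V_def algebra_simps)
    qed (use F[OF M, of "B * h"] A B h \<tau> V n in auto)
    \<comment> \<open>There are at most \<open>N = T / \<tau>\<close> steps: this turns the local
      error of order \<open>p + 1\<close> into order \<open>p\<close> and divides the projection
      error by \<open>\<tau>\<close>.\<close>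
    also have "real n * (A * \<tau> ^ Suc p + 3 * (B * h)) \<le> real N * (A * \<tau> ^ Suc p + 3 * (B * h))"
      using n A B h \<tau> by (intro mult_right_mono) auto
    also have "\<dots> = T * (A * \<tau> ^ p + 3 * B * (h / \<tau>))"
      using \<tau> by (simp add: field_simps flip: N\<tau>)
    also have "\<dots> \<le> T * ((A + 3 * B) * \<tau> ^ p + (A + 3 * B) * (h / \<tau>))"
      using T A B h \<tau> by (intro mult_left_mono add_mono mult_right_mono) auto
    also have "\<dots> = (A + 3 * B) * T * (h / \<tau> + \<tau> ^ p)"
      by (simp add: algebra_simps)
    finally show ?thesis
      by (simp add: V_def h_def \<tau>_def)
  qed
  show ?thesis
    using main A B by (intro exI[of _ "A + 3 * B"]) (simp add: Let_def)
qed

theorem theorem3p1: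
  fixes k p :: nat and \<sigma> T :: real
    and v0 :: "real \<Rightarrow> real" and v :: "real \<Rightarrow> real \<Rightarrow> real"
  assumes "p \<in> {1, 2, 3}"
    and "T > 0"
    and "periodic_heat_solution \<sigma> T v0 v"
    and "bounded_x_derivative (max (k + 2) (2 * p + 2)) T v"
  shows "(\<exists>C\<ge>0. \<forall>N\<ge>1. \<forall>M\<ge>1. \<forall>n\<le>N.
            let \<tau> = T / real N; h = 1 / real M;
                u = (\<lambda>m. (SLDG p k M \<sigma> \<tau> ^^ m) (DG_proj k M v0))
            in L2_norm01 (\<lambda>x. v (real n * \<tau>) x - u n x)
                 \<le> L2_norm01 (\<lambda>x. v 0 x - u 0 x) + C * T * (h ^ (k + 1) / \<tau> + \<tau> ^ p))
       \<and> (p = 2 \<longrightarrow> (\<exists>C\<ge>0. \<forall>N\<ge>1. \<forall>M\<ge>1. \<forall>n\<le>N.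
            let \<tau> = T / real N; h = 1 / real M;
                u = (\<lambda>m. (SLDG2_variant k M \<sigma> \<tau> ^^ m) (DG_proj k M v0))
            in L2_norm01 (\<lambda>x. v (real n * \<tau>) x - u n x)
                 \<le> L2_norm01 (\<lambda>x. v 0 x - u 0 x) + C * T * (h ^ (k + 1) / \<tau> + \<tau> ^ p)))
       \<and> (p = 3 \<longrightarrow> (\<exists>C\<ge>0. \<forall>N\<ge>1. \<forall>M\<ge>1. \<forall>n\<le>N.
            let \<tau> = T / real N; h = 1 / real M;
                u = (\<lambda>m. (SLDG3_variant k M \<sigma> \<tau> ^^ m) (DG_proj k M v0))
            in L2_norm01 (\<lambda>x. v (real n * \<tau>) x - u n x)
                 \<le> L2_norm01 (\<lambda>x. v 0 x - u 0 x) + C * T * (h ^ (k + 1) / \<tau> + \<tau> ^ p)))"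
proof (intro conjI impI)
  note conv = scheme_convergence[OF assms]
  \<comment> \<open>A variant projects once per step; its error \<open>\<eta>\<close> is relaxed to
    \<open>3 * \<eta>\<close> to fit the common form.\<close>
  have variant_step: "DG_proj k M (op_comb 3 (sldg_coeff p) (S0_op \<sigma> \<tau>) u) \<in> periodic_bdd \<and>
      L2_dist (op_comb 3 (sldg_coeff p) (S0_op \<sigma> \<tau>) f) (DG_proj k M (op_comb 3 (sldg_coeff p) (S0_op \<sigma> \<tau>) u))
        \<le> L2_dist f u + 3 * \<eta>"
    if "M \<ge> 1" "0 \<le> \<eta>" "DG_approx k M \<eta> f" "u \<in> periodic_bdd" for M \<tau> \<eta> f u
    using DG_proj_op_comb_step[of M 3 "sldg_coeff p" k \<eta> f u \<sigma> \<tau>, OF that(1) sldg_coeff_nonneg sldg_coeff_sum that(3,4)]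
      that(2) by auto
  show "\<exists>C\<ge>0. \<forall>N\<ge>1. \<forall>M\<ge>1. \<forall>n\<le>N.
            let \<tau> = T / real N; h = 1 / real M;
                u = (\<lambda>m. (SLDG p k M \<sigma> \<tau> ^^ m) (DG_proj k M v0))
            in L2_norm01 (\<lambda>x. v (real n * \<tau>) x - u n x)
                 \<le> L2_norm01 (\<lambda>x. v 0 x - u 0 x) + C * T * (h ^ (k + 1) / \<tau> + \<tau> ^ p)"
    unfolding SLDG_eq_op_comb[OF assms(1)]
  proof (rule conv)
    fix M :: nat and \<tau> \<eta> :: real and f u :: "real \<Rightarrow> real"
    assume "M \<ge> 1" "0 \<le> \<eta>" "DG_approx k M \<eta> f" "u \<in> periodic_bdd"
    then show "op_comb 3 (sldg_coeff p) (S_op k M \<sigma> \<tau>) u \<in> periodic_bdd \<and>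
        L2_dist (op_comb 3 (sldg_coeff p) (S0_op \<sigma> \<tau>) f) (op_comb 3 (sldg_coeff p) (S_op k M \<sigma> \<tau>) u)
          \<le> L2_dist f u + 3 * \<eta>"
      using op_comb_S_op_step[of M 3 "sldg_coeff p" \<eta> k f u \<sigma> \<tau>] sldg_coeff_nonneg sldg_coeff_sum by simp
  qed
  show "\<exists>C\<ge>0. \<forall>N\<ge>1. \<forall>M\<ge>1. \<forall>n\<le>N.
            let \<tau> = T / real N; h = 1 / real M;
                u = (\<lambda>m. (SLDG2_variant k M \<sigma> \<tau> ^^ m) (DG_proj k M v0))
            in L2_norm01 (\<lambda>x. v (real n * \<tau>) x - u n x)
                 \<le> L2_norm01 (\<lambda>x. v 0 x - u 0 x) + C * T * (h ^ (k + 1) / \<tau> + \<tau> ^ p)" if "p = 2"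
    using variant_step unfolding \<open>p = 2\<close> SLDG2_variant_eq_op_comb[symmetric] by (rule conv[unfolded \<open>p = 2\<close>])
  show "\<exists>C\<ge>0. \<forall>N\<ge>1. \<forall>M\<ge>1. \<forall>n\<le>N.
            let \<tau> = T / real N; h = 1 / real M;
                u = (\<lambda>m. (SLDG3_variant k M \<sigma> \<tau> ^^ m) (DG_proj k M v0))
            in L2_norm01 (\<lambda>x. v (real n * \<tau>) x - u n x)
                 \<le> L2_norm01 (\<lambda>x. v 0 x - u 0 x) + C * T * (h ^ (k + 1) / \<tau> + \<tau> ^ p)" if "p = 3"
    using variant_step unfolding \<open>p = 3\<close> SLDG3_variant_eq_op_comb[symmetric] by (rule conv[unfolded \<open>p = 3\<close>])
qed

end
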